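(* Let $n\ge 2$, $A\in GL(n,\mathbb{R})$, $v\in\mathbb{R}^n$, and suppose the affine diffeomorphism $f_{A,v}(x)=Ax+v$ of $\mathbb{R}^n$ has no fixed point. Then $f_{A,v}$ is a boundary point of $\mathscr{D}_n$ in the two-sided weak $C^1_{\mathrm{loc}}$ topology on $\operatorname{Diff}^1(\mathbb{R}^n)$. More precisely, there exist smooth diffeomorphisms $h_\varepsilon\notin\mathscr{D}_n$ of $\mathbb{R}^n$ (for $\varepsilon\neq 0$ small) such that $h_\varepsilon\to f_{A,v}$ and $h_\varepsilon^{-1}\to f_{A,v}^{-1}$ in $C^\infty$ on compact subsets as $\varepsilon\to 0$.
   Context: $\mathscr{D}_n=\{f\in\operatorname{Diff}^1(\mathbb{R}^n): f$ admits a complete Anosov metric$\}$, i.e. those $f$ for which there is a complete Riemannian metric on $\mathbb{R}^n$ with respect to which $f$ is Anosov. A diffeomorphism $f$ of a smooth manifold $M$ is Anosov with respect to a Riemannian metric $\rho$ if there are a continuous $Df$-invariant splitting $TM=E^s\oplus E^u$ (possibly trivial: $E^s=\{0\}$ or $E^u=\{0\}$ allowed) and constants $C\ge 1$, $\lambda\in(0,1)$ such that for all integers $m\ge 0$: $\|Df^m(w)\|_\rho\le C\lambda^m\|w\|_\rho$ for $w\in E^s$ and $\|Df^{-m}(w)\|_\rho\le C\lambda^m\|w\|_\rho$ for $w\in E^u$. The two-sided weak $C^1_{\mathrm{loc}}$ topology on $\operatorname{Diff}^1(\mathbb{R}^n)$ is the initial topology induced by $h\mapsto(h,h^{-1})$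 from the product $C^1(\mathbb{R}^n,\mathbb{R}^n)\times C^1(\mathbb{R}^n,\mathbb{R}^n)$, each factor carrying the weak $C^1$ topology (uniform convergence of maps and first derivatives on compact sets). *)

theory Defs
  imports "HOL-Analysis.Analysis"
begin

section \<open>Maps of class \<open>C\<^sup>k\<close> and \<open>C\<^sup>\<infinity>\<close> convergence\<close>

text \<open>\<open>iter_deriv [v\<^sub>1, \<dots>, v\<^sub>k] f x\<close> is the \<open>k\<close>-th derivative of \<open>f\<close> at \<open>x\<close> applied to
  \<open>(v\<^sub>1, \<dots>, v\<^sub>k)\<close>. It is meaningful only if \<open>f\<close> is \<open>k\<close> times differentiable, since
  \<^const>\<open>frechet_derivative\<close> is unspecified where the derivative does not exist.\<close>

primrec iter_deriv ::
    "'a::euclidean_space list \<Rightarrow> ('a \<Rightarrow> 'b::real_normed_vector) \<Rightarrow> 'a \<Rightarrow> 'b" where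
  "iter_deriv [] f = f"
| "iter_deriv (v # vs) f = iter_deriv vs (\<lambda>x. frechet_derivative f (at x) v)"

text \<open>As the domain is finite-dimensional, a derivative depends continuously on the base point
  in operator norm iff each of its directional derivatives does.\<close>

primrec Ck :: "nat \<Rightarrow> ('a::euclidean_space \<Rightarrow> 'b::real_normed_vector) \<Rightarrow> bool" where
  "Ck 0 f \<longleftrightarrow> continuous_on UNIV f"
| "Ck (Suc k) f \<longleftrightarrow>
     (\<forall>x. f differentiable (at x)) \<and> (\<forall>v. Ck k (\<lambda>x. frechet_derivative f (at x) v))"

definition smooth :: "('a::euclidean_space \<Rightarrow> 'b::real_normed_vector) \<Rightarrow> bool" where
  "smooth f \<longleftrightarrow> (\<forall>k. Ck k f)"

definition smooth_diffeo :: "('a::euclidean_space \<Rightarrow> 'a) \<Rightarrow> bool" where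
  "smooth_diffeo f \<longleftrightarrow> bij f \<and> smooth f \<and> smooth (inv f)"

definition Cinf_loc_tendsto ::
    "('i \<Rightarrow> 'a::euclidean_space \<Rightarrow> 'b::real_normed_vector) \<Rightarrow> ('a \<Rightarrow> 'b) \<Rightarrow> 'i filter \<Rightarrow> bool" where
  "Cinf_loc_tendsto h f F \<longleftrightarrow>
     (\<forall>vs K. compact K \<longrightarrow> uniform_limit K (\<lambda>i. iter_deriv vs (h i)) (iter_deriv vs f) F)"


section \<open>The two-sided weak \<open>C\<^sup>1\<close> topology on \<open>Diff\<^sup>1\<close>\<close>

definition weak_C1_nbhd ::
    "('a::euclidean_space \<Rightarrow> 'b::real_normed_vector) \<Rightarrow> 'a set \<Rightarrow> real \<Rightarrow> ('a \<Rightarrow> 'b) set" where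
  "weak_C1_nbhd f K e = {g. Ck 1 g \<and> (\<forall>x\<in>K. dist (g x) (f x) < e \<and>
     onorm (\<lambda>v. frechet_derivative g (at x) v - frechet_derivative f (at x) v) < e)}"

definition weak_C1_topology :: "('a::euclidean_space \<Rightarrow> 'b::real_normed_vector) topology" where
  "weak_C1_topology =
     topology_generated_by {weak_C1_nbhd f K e | f K e. Ck 1 f \<and> compact K \<and> 0 < e}"

definition Diff1 :: "('a::euclidean_space \<Rightarrow> 'a) set" where
  "Diff1 = {f. bij f \<and> Ck 1 f \<and> Ck 1 (inv f)}"

definition Diff1_topology :: "('a::euclidean_space \<Rightarrow> 'a) topology" where
  "Diff1_topology =
     pullback_topology Diff1 (\<lambda>h. (h, inv h)) (prod_topology weak_C1_topology weak_C1_topology)"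

lemma topspace_weak_C1_topology: "topspace weak_C1_topology = {f. Ck 1 f}"
proof -
  have "f \<in> weak_C1_nbhd f {} 1" if "Ck 1 f" for f :: "'a \<Rightarrow> 'b"
    using that unfolding weak_C1_nbhd_def by blast
  moreover have "weak_C1_nbhd f K e \<subseteq> {g. Ck 1 g}" for f :: "'a \<Rightarrow> 'b" and K e
    unfolding weak_C1_nbhd_def by blast
  ultimately show ?thesis
    unfolding weak_C1_topology_def topology_generated_by_topspace
    using compact_empty zero_less_one by blast
qed

lemma topspace_Diff1_topology: "topspace Diff1_topology = Diff1"
  unfolding Diff1_topology_def topspace_pullback_topology topspace_prod_topology
    topspace_weak_C1_topology Diff1_def by blast


section \<open>Complete Riemannian metrics\<close>

text \<open>All tangent spaces are identified with the ambient vector space; \<open>\<rho> x u w\<close> is the inner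
  product of \<open>u\<close> and \<open>w\<close> in the tangent space at \<open>x\<close>.\<close>

definition riemannian_metric :: "('a::euclidean_space \<Rightarrow> 'a \<Rightarrow> 'a \<Rightarrow> real) \<Rightarrow> bool" where
  "riemannian_metric \<rho> \<longleftrightarrow>
     (\<forall>x. bilinear (\<rho> x)) \<and>
     (\<forall>x u w. \<rho> x u w = \<rho> x w u) \<and>
     (\<forall>x u. u \<noteq> 0 \<longrightarrow> \<rho> x u u > 0) \<and>
     (\<forall>u w. smooth (\<lambda>x. \<rho> x u w))"

definition rnorm :: "('a::euclidean_space \<Rightarrow> 'a \<Rightarrow> 'a \<Rightarrow> real) \<Rightarrow> 'a \<Rightarrow> 'a \<Rightarrow> real" where
  "rnorm \<rho> x w = sqrt (\<rho> x w w)"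

text \<open>The curves admitted by \<^const>\<open>valid_path\<close> may have unbounded speed near finitely many
  parameters. Requiring the speed to have an integral excludes curves of infinite length, which
  a plain \<^const>\<open>integral\<close> would assign the value \<open>0\<close>; it does not change the infimum.\<close>

definition rdist :: "('a::euclidean_space \<Rightarrow> 'a \<Rightarrow> 'a \<Rightarrow> real) \<Rightarrow> 'a \<Rightarrow> 'a \<Rightarrow> real" where
  "rdist \<rho> x y = Inf {L. \<exists>\<gamma>. valid_path \<gamma> \<and> pathstart \<gamma> = x \<and> pathfinish \<gamma> = y \<and>
     ((\<lambda>t. rnorm \<rho> (\<gamma> t) (vector_derivative \<gamma> (at t))) has_integral L) {0..1}}"

definition complete_metric :: "('a::euclidean_space \<Rightarrow> 'a \<Rightarrow> 'a \<Rightarrow> real) \<Rightarrow> bool" where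
  "complete_metric \<rho> \<longleftrightarrow>
     (\<forall>\<sigma>. (\<forall>e>0. \<exists>N. \<forall>m\<ge>N. \<forall>n\<ge>N. rdist \<rho> (\<sigma> m) (\<sigma> n) < e) \<longrightarrow>
        (\<exists>l. (\<lambda>n. rdist \<rho> (\<sigma> n) l) \<longlonglongrightarrow> 0))"


section \<open>Anosov diffeomorphisms\<close>

text \<open>A continuous field of subspaces, described by continuous local frames
  \<open>X 0, \<dots>, X (k - 1)\<close>; \<open>k = 0\<close> gives the zero subbundle.\<close>

definition continuous_subbundle :: "('a::euclidean_space \<Rightarrow> 'a set) \<Rightarrow> bool" where
  "continuous_subbundle E \<longleftrightarrow>
     (\<forall>x. \<exists>U (k::nat) X. open U \<and> x \<in> U \<and> (\<forall>i<k. continuous_on U (X i)) \<and>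
        (\<forall>y\<in>U. inj_on (\<lambda>i. X i y) {..<k} \<and> independent ((\<lambda>i. X i y) ` {..<k}) \<and>
               span ((\<lambda>i. X i y) ` {..<k}) = E y))"

definition invariant_splitting ::
    "('a::euclidean_space \<Rightarrow> 'a) \<Rightarrow> ('a \<Rightarrow> 'a set) \<Rightarrow> ('a \<Rightarrow> 'a set) \<Rightarrow> bool" where
  "invariant_splitting f Es Eu \<longleftrightarrow>
     continuous_subbundle Es \<and> continuous_subbundle Eu \<and>
     (\<forall>x. Es x \<inter> Eu x = {0} \<and> {a + b | a b. a \<in> Es x \<and> b \<in> Eu x} = UNIV) \<and>
     (\<forall>x. frechet_derivative f (at x) ` Es x = Es (f x)) \<and>
     (\<forall>x. frechet_derivative f (at x) ` Eu x = Eu (f x))"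

definition anosov_wrt ::
    "('a::euclidean_space \<Rightarrow> 'a \<Rightarrow> 'a \<Rightarrow> real) \<Rightarrow> ('a \<Rightarrow> 'a) \<Rightarrow> bool" where
  "anosov_wrt \<rho> f \<longleftrightarrow>
     (\<exists>Es Eu C l. invariant_splitting f Es Eu \<and> 1 \<le> C \<and> 0 < l \<and> l < 1 \<and>
        (\<forall>m x. \<forall>w\<in>Es x.
           rnorm \<rho> ((f ^^ m) x) (frechet_derivative (f ^^ m) (at x) w) \<le> C * l ^ m * rnorm \<rho> x w) \<and>
        (\<forall>m x. \<forall>w\<in>Eu x.
           rnorm \<rho> ((inv f ^^ m) x) (frechet_derivative (inv f ^^ m) (at x) w)
             \<le> C * l ^ m * rnorm \<rho> x w))"

definition anosov_diffs :: "('a::euclidean_space \<Rightarrow> 'a) set" where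
  "anosov_diffs =
     {f \<in> Diff1. \<exists>\<rho>. riemannian_metric \<rho> \<and> complete_metric \<rho> \<and> anosov_wrt \<rho> f}"

end

theory Submission
  imports Defs "HOL-Computational_Algebra.Fundamental_Theorem_Algebra"
begin

text \<open>For \<open>t > 0\<close> outside a finite set \<open>t A\<close> has no eigenvalue on the unit circle, and then
  \<open>x \<mapsto> t A x + v\<close> is Anosov for the Euclidean metric; letting \<open>t \<longlongrightarrow> 1\<close> puts \<open>f x = A x + v\<close> in the
  closure of the Anosov diffeomorphisms. For the splitting, the coordinates of an orbit \<open>m \<mapsto> A\<^sup>m w\<close>,
  \<open>m \<in> \<int>\<close>, satisfy a linear recurrence whose characteristic polynomial \<open>p\<close> annihilates \<open>A\<close>; a Bezout
  identity between the factors of \<open>p\<close> with roots inside and outside the circle splits \<open>w\<close> into a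
  part decaying forwards and one decaying backwards.

  Conversely, a fixed point at which the derivative has a nonzero invariant vector excludes every
  Anosov metric. As \<open>f\<close> has no fixed point, \<open>A\<close> has an eigenvector \<open>k\<close> for the eigenvalue \<open>1\<close>, and
  because \<open>n \<ge> 2\<close> there is a \<open>z\<close> such that \<open>w = A z + v - z\<close> is not proportional to \<open>k\<close>. Choose \<open>c\<close>
  orthogonal to \<open>w\<close> with \<open>c \<bullet> k = 1\<close>. The shear \<open>y \<mapsto> y + ((1 - \<epsilon> (c \<bullet> y))\<^sup>2 - 1) w\<close> is polynomial with
  polynomial inverse and tends to the identity. Composing it with \<open>f\<close> creates a fixed point on the
  line \<open>z + \<real> k\<close>, where \<open>c \<bullet> x = 1 / \<epsilon>\<close>; the shear is stationary there, so the derivative is \<open>A\<close>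
  and fixes \<open>k\<close>.\<close>

subsection \<open>Smooth maps\<close>

lemma frechet_derivative_eqI:
  "(f has_derivative f') (at x) \<Longrightarrow> frechet_derivative f (at x) = f'"
  using frechet_derivative_at by metis

lemma Ck_Suc_imp_Ck: "Ck (Suc k) f \<Longrightarrow> Ck k f"
proof (induction k arbitrary: f)
  case 0
  then show ?case
    by (auto intro!: continuous_at_imp_continuous_on differentiable_imp_continuous_within)
next
  case (Suc k)
  then show ?case by (metis Ck.simps(2))
qed

lemma Ck_const: "Ck k (\<lambda>x. c)"
  by (induction k arbitrary: c) (auto simp: frechet_derivative_const)

lemma Ck_bounded_linear:
  assumes "bounded_linear L"
  shows "Ck k L"
proof (cases k)
  case 0
  then show ?thesis using assms by (simp add: linear_continuous_on)
next
  case (Suc l)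
  have D: "(L has_derivative L) (at x)" for x
    using assms by (rule bounded_linear_imp_has_derivative)
  then have "L differentiable (at x)" for x by (auto simp: differentiable_def)
  then show ?thesis by (simp add: Suc frechet_derivative_eqI[OF D] Ck_const)
qed

lemma frechet_derivative_add:
  assumes "f differentiable (at x)" "g differentiable (at x)"
  shows "frechet_derivative (\<lambda>x. f x + g x) (at x) v =
    frechet_derivative f (at x) v + frechet_derivative g (at x) v"
proof -
  have "((\<lambda>x. f x + g x) has_derivative
      (\<lambda>v. frechet_derivative f (at x) v + frechet_derivative g (at x) v)) (at x)"
    using assms by (intro has_derivative_add) (simp_all add: frechet_derivative_works[symmetric])
  then show ?thesis by (simp add: frechet_derivative_eqI)
qed

lemma Ck_add: "Ck k f \<Longrightarrow> Ck k g \<Longrightarrow> Ck k (\<lambda>x. f x + g x)"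
proof (induction k arbitrary: f g)
  case 0
  then show ?case by (simp add: continuous_on_add)
next
  case (Suc k)
  then show ?case by (simp add: frechet_derivative_add)
qed

lemma frechet_derivative_scaleR_fun:
  fixes f :: "'a::real_normed_vector \<Rightarrow> real"
  assumes "f differentiable (at x)" "g differentiable (at x)"
  shows "frechet_derivative (\<lambda>x. f x *\<^sub>R g x) (at x) v =
    f x *\<^sub>R frechet_derivative g (at x) v + frechet_derivative f (at x) v *\<^sub>R g x"
proof -
  have "((\<lambda>x. f x *\<^sub>R g x) has_derivative (\<lambda>v. f x *\<^sub>R frechet_derivative g (at x) v +
      frechet_derivative f (at x) v *\<^sub>R g x)) (at x)"
    using assms by (intro has_derivative_scaleR) (simp_all add: frechet_derivative_works[symmetric])
  then show ?thesis by (simp add: frechet_derivative_eqI)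
qed

lemma Ck_scaleR:
  fixes f :: "'a::euclidean_space \<Rightarrow> real"
  shows "Ck k f \<Longrightarrow> Ck k g \<Longrightarrow> Ck k (\<lambda>x. f x *\<^sub>R g x)"
proof (induction k arbitrary: f g)
  case 0
  then show ?case by (simp add: continuous_on_scaleR)
next
  case (Suc k)
  \<comment> \<open>The product rule leaves one factor of each summand undifferentiated, and the
    induction hypothesis wants that factor in class \<open>Ck k\<close>.\<close>
  then have "Ck k f" "Ck k g" by (blast intro: Ck_Suc_imp_Ck)+
  with Suc show ?case by (simp add: frechet_derivative_scaleR_fun Ck_add differentiable_scaleR)
qed

lemma smooth_const: "smooth (\<lambda>x. c)"
  by (simp add: smooth_def Ck_const)

lemma smooth_bounded_linear: "bounded_linear L \<Longrightarrow> smooth L"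
  by (simp add: smooth_def Ck_bounded_linear)

lemma smooth_add: "smooth f \<Longrightarrow> smooth g \<Longrightarrow> smooth (\<lambda>x. f x + g x)"
  by (simp add: smooth_def Ck_add)

lemma smooth_scaleR:
  fixes f :: "'a::euclidean_space \<Rightarrow> real"
  shows "smooth f \<Longrightarrow> smooth g \<Longrightarrow> smooth (\<lambda>x. f x *\<^sub>R g x)"
  by (simp add: smooth_def Ck_scaleR)

lemma smooth_differentiable: "smooth f \<Longrightarrow> f differentiable (at x)"
  by (metis Ck.simps(2) smooth_def)

lemma smooth_frechet_derivative:
  "smooth f \<Longrightarrow> smooth (\<lambda>x. frechet_derivative f (at x) v)"
  unfolding smooth_def by (metis Ck.simps(2))

lemma continuous_on_iter_deriv: "smooth f \<Longrightarrow> continuous_on UNIV (iter_deriv vs f)"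
proof (induction vs arbitrary: f)
  case Nil
  then show ?case by (metis Ck.simps(1) iter_deriv.simps(1) smooth_def)
qed (simp add: smooth_frechet_derivative)

lemma iter_deriv_add:
  "smooth f \<Longrightarrow> smooth g \<Longrightarrow>
    iter_deriv vs (\<lambda>x. f x + g x) = (\<lambda>x. iter_deriv vs f x + iter_deriv vs g x)"
  by (induction vs arbitrary: f g)
    (simp_all add: frechet_derivative_add smooth_differentiable smooth_frechet_derivative)

lemma iter_deriv_cmul:
  "smooth f \<Longrightarrow> iter_deriv vs (\<lambda>x. c *\<^sub>R f x) = (\<lambda>x. c *\<^sub>R iter_deriv vs f x)"
  by (induction vs arbitrary: f)
    (simp_all add: frechet_derivative_scaleR_fun smooth_differentiable smooth_frechet_derivative
      frechet_derivative_const)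

text \<open>All families in the proof have this shape: fixed smooth maps with scalar coefficients
  tending to 0. Iterated derivatives are linear on smooth maps, and those of \<open>P\<close> and
  \<open>Q\<close> are bounded on compact sets.\<close>

lemma Cinf_loc_tendsto_perturb:
  fixes f :: "'a::euclidean_space \<Rightarrow> 'b::real_normed_vector"
  assumes f: "smooth f" and P: "smooth P" and Q: "smooth Q"
    and a: "(a \<longlongrightarrow> 0) F" and b: "(b \<longlongrightarrow> 0) F"
  shows "Cinf_loc_tendsto (\<lambda>i x. f x + a i *\<^sub>R P x + b i *\<^sub>R Q x) f F"
  unfolding Cinf_loc_tendsto_def
proof (intro allI impI)
  fix vs :: "'a list" and K :: "'a set"
  assume K: "compact K"
  have lim: "uniform_limit K (\<lambda>i x. c i *\<^sub>R iter_deriv vs g x) (\<lambda>x. 0) F"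
    if g: "smooth g" and c: "(c \<longlongrightarrow> 0) F" for c and g :: "'a \<Rightarrow> 'b"
  proof -
    have "bounded (iter_deriv vs g ` K)"
      by (meson K compact_continuous_image compact_imp_bounded continuous_on_iter_deriv
          continuous_on_subset g top_greatest)
    then obtain B where B: "B > 0" "\<And>x. x \<in> K \<Longrightarrow> norm (iter_deriv vs g x) \<le> B"
      by (force simp: bounded_pos)
    show ?thesis
    proof (rule uniform_limitI)
      fix e :: real assume "e > 0"
      then have "\<forall>\<^sub>F i in F. \<bar>c i\<bar> < e / B"
        using c B(1) tendstoD[of c 0 F "e / B"] by (simp add: dist_real_def)
      then show "\<forall>\<^sub>F i in F. \<forall>x\<in>K. dist (c i *\<^sub>R iter_deriv vs g x) 0 < e"
      proof (rule eventually_mono)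
        fix i assume i: "\<bar>c i\<bar> < e / B"
        have "\<bar>c i\<bar> * norm (iter_deriv vs g x) < e" if "x \<in> K" for x
        proof -
          have "\<bar>c i\<bar> * norm (iter_deriv vs g x) \<le> \<bar>c i\<bar> * B"
            by (simp add: B(2) mult_left_mono that)
          also have "\<dots> < e" using i B(1) by (simp add: field_simps)
          finally show ?thesis .
        qed
        then show "\<forall>x\<in>K. dist (c i *\<^sub>R iter_deriv vs g x) 0 < e" by simp
      qed
    qed
  qed
  have cmul: "smooth (\<lambda>x. c *\<^sub>R g x)" if "smooth g" for c and g :: "'a \<Rightarrow> 'b"
    using that by (intro smooth_scaleR smooth_const)
  have "iter_deriv vs (\<lambda>x. f x + a i *\<^sub>R P x + b i *\<^sub>R Q x) =
      (\<lambda>x. iter_deriv vs f x + a i *\<^sub>R iter_deriv vs P x + b i *\<^sub>R iter_deriv vs Q x)" for i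
    by (simp add: iter_deriv_add iter_deriv_cmul smooth_add cmul f P Q)
  moreover have "uniform_limit K
      (\<lambda>i x. iter_deriv vs f x + a i *\<^sub>R iter_deriv vs P x + b i *\<^sub>R iter_deriv vs Q x)
      (\<lambda>x. iter_deriv vs f x + 0 + 0) F"
    by (intro uniform_limit_add lim assms uniform_limit_const)
  ultimately show "uniform_limit K
      (\<lambda>i. iter_deriv vs (\<lambda>x. f x + a i *\<^sub>R P x + b i *\<^sub>R Q x)) (iter_deriv vs f) F"
    by simp
qed


subsection \<open>Convergence in the weak topology\<close>

text \<open>Passes from the directional derivatives, which \<open>iter_deriv\<close> controls, to
  the operator norm in \<open>weak_C1_nbhd\<close>.\<close>

lemma onorm_le_sum_Basis:
  fixes L :: "'a::euclidean_space \<Rightarrow> 'b::real_normed_vector"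
  assumes "linear L"
  shows "onorm L \<le> (\<Sum>b\<in>Basis. norm (L b))"
proof (rule onorm_le)
  fix x
  have "L x = L (\<Sum>b\<in>Basis. (x \<bullet> b) *\<^sub>R b)" by (simp add: euclidean_representation)
  also have "\<dots> = (\<Sum>b\<in>Basis. (x \<bullet> b) *\<^sub>R L b)"
    using assms by (simp add: linear_sum linear_scale)
  also have "norm \<dots> \<le> (\<Sum>b\<in>Basis. norm (L b) * norm x)"
    by (intro sum_norm_le) (simp add: Basis_le_norm mult.commute[of _ "norm x"] mult_right_mono)
  finally show "norm (L x) \<le> (\<Sum>b\<in>Basis. norm (L b)) * norm x"
    by (simp add: sum_distrib_right)
qed

lemma Ck_1_bounded_linear_frechet_derivative:
  "Ck 1 f \<Longrightarrow> bounded_linear (frechet_derivative f (at x))"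
  by (metis Ck.simps(2) One_nat_def frechet_derivative_works has_derivative_bounded_linear)

text \<open>By the triangle inequality the operator norm changes by at most the sum, over the basis,
  of the changes of the directional derivatives; these are continuous by
  \<open>Ck 1\<close>.\<close>

lemma continuous_on_onorm_frechet_derivative_diff:
  fixes f g :: "'a::euclidean_space \<Rightarrow> 'b::real_normed_vector"
  assumes f: "Ck 1 f" and g: "Ck 1 g"
  shows "continuous_on UNIV
    (\<lambda>x. onorm (\<lambda>v. frechet_derivative g (at x) v - frechet_derivative f (at x) v))"
    (is "continuous_on UNIV (\<lambda>x. onorm (?D x))")
proof -
  have bl: "bounded_linear (?D x)" for x
    using f g by (intro bounded_linear_sub Ck_1_bounded_linear_frechet_derivative)
  have tri: "onorm (?D y) \<le> onorm (?D x) + (\<Sum>b\<in>Basis. norm (?D y b - ?D x b))" for x y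
  proof -
    have "onorm (?D y) = onorm (\<lambda>v. ?D x v + (?D y v - ?D x v))" by simp
    also have "\<dots> \<le> onorm (?D x) + onorm (\<lambda>v. ?D y v - ?D x v)"
      by (intro onorm_triangle bounded_linear_sub bl)
    also have "onorm (\<lambda>v. ?D y v - ?D x v) \<le> (\<Sum>b\<in>Basis. norm (?D y b - ?D x b))"
      by (intro onorm_le_sum_Basis bounded_linear.linear bounded_linear_sub bl)
    finally show ?thesis by simp
  qed
  have cont: "continuous_on UNIV (\<lambda>x. ?D x b)" for b
    using f g by (intro continuous_on_diff) simp_all
  have "((\<lambda>y. onorm (?D y)) \<longlongrightarrow> onorm (?D x)) (at x)" for x
  proof -
    have "((\<lambda>y. \<Sum>b\<in>Basis. norm (?D y b - ?D x b)) \<longlongrightarrow> 0) (at x)"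
    proof (rule tendsto_null_sum)
      fix b :: 'a
      have "((\<lambda>y. ?D y b) \<longlongrightarrow> ?D x b) (at x)"
        using cont[of b] by (simp add: continuous_on_def)
      then show "((\<lambda>y. norm (?D y b - ?D x b)) \<longlongrightarrow> 0) (at x)"
        by (simp add: LIM_zero tendsto_norm_zero)
    qed
    moreover have "norm (onorm (?D y) - onorm (?D x)) \<le> (\<Sum>b\<in>Basis. norm (?D y b - ?D x b))" for y
    proof -
      have "(\<Sum>b\<in>Basis. norm (?D y b - ?D x b)) = (\<Sum>b\<in>Basis. norm (?D x b - ?D y b))"
        by (simp add: norm_minus_commute)
      then show ?thesis using tri[of x y] tri[of y x] by simp
    qed
    ultimately have "((\<lambda>y. onorm (?D y) - onorm (?D x)) \<longlongrightarrow> 0) (at x)"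
      by (rule Lim_null_comparison[OF always_eventually, OF allI, rotated])
    then show ?thesis by (rule LIM_zero_cancel)
  qed
  then show ?thesis by (simp add: continuous_on_def)
qed

text \<open>The maximum over \<open>K\<close> is attained and lies below \<open>e\<close>. The
  margin \<open>d\<close> is what a nearby map may use up.\<close>

lemma compact_less_imp_uniform:
  fixes f :: "'a::topological_space \<Rightarrow> real"
  assumes "compact K" "continuous_on K f" "\<And>x. x \<in> K \<Longrightarrow> f x < e"
  shows "\<exists>d>0. \<forall>x\<in>K. f x + d \<le> e"
proof (cases "K = {}")
  case True
  then show ?thesis by (auto intro: exI[of _ 1])
next
  case False
  then obtain y where "y \<in> K" "\<forall>x\<in>K. f x \<le> f y"
    using continuous_attains_sup[OF assms(1) _ assms(2)] by blast
  then show ?thesis using assms(3)[of y] by (intro exI[of _ "e - f y"]) auto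
qed

text \<open>The neighbourhood is centred at \<open>g\<close> and not at the limit \<open>f\<close>,
  so it is reached by the triangle inequality through \<open>f\<close>, using the margins that
  compactness leaves between \<open>f\<close> and the bound \<open>e\<close>.\<close>

lemma Cinf_loc_tendsto_imp_eventually_weak_C1_nbhd:
  fixes f :: "'a::euclidean_space \<Rightarrow> 'b::real_normed_vector"
  assumes h: "\<And>i. Ck 1 (h i)" and f: "Ck 1 f" and lim: "Cinf_loc_tendsto h f F"
    and g: "Ck 1 g" and K: "compact K" and fin: "f \<in> weak_C1_nbhd g K e"
  shows "\<forall>\<^sub>F i in F. h i \<in> weak_C1_nbhd g K e"
proof -
  let ?D = "\<lambda>f x v. frechet_derivative f (at x) v"
  have bl: "bounded_linear (\<lambda>v. ?D p x v - ?D q x v)" if "Ck 1 p" "Ck 1 q" for p q :: "'a \<Rightarrow> 'b" and x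
    using that by (intro bounded_linear_sub Ck_1_bounded_linear_frechet_derivative)
  have "continuous_on K p" if "Ck 1 p" for p :: "'a \<Rightarrow> 'b"
    using Ck_Suc_imp_Ck[of 0 p] that by (simp add: continuous_on_subset[OF _ subset_UNIV])
  then have "continuous_on K (\<lambda>x. dist (f x) (g x))"
    using f g by (intro continuous_on_dist) blast+
  with K fin obtain d1 where d1: "d1 > 0" "\<And>x. x \<in> K \<Longrightarrow> dist (f x) (g x) + d1 \<le> e"
    using compact_less_imp_uniform[of K "\<lambda>x. dist (f x) (g x)" e] by (auto simp: weak_C1_nbhd_def)
  have "continuous_on K (\<lambda>x. onorm (\<lambda>v. ?D f x v - ?D g x v))"
    using continuous_on_onorm_frechet_derivative_diff[OF g f] by (rule continuous_on_subset) simp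
  with K fin obtain d2 where d2: "d2 > 0"
      "\<And>x. x \<in> K \<Longrightarrow> onorm (\<lambda>v. ?D f x v - ?D g x v) + d2 \<le> e"
    using compact_less_imp_uniform[of K "\<lambda>x. onorm (\<lambda>v. ?D f x v - ?D g x v)" e]
    by (auto simp: weak_C1_nbhd_def)
  \<comment> \<open>Each of the \<open>DIM('a)\<close> basis directions may use an equal share of
    the margin \<open>d2\<close>.\<close>
  define d where "d = d2 / real (DIM('a))"
  have "d > 0" using d2 by (simp add: d_def)
  have lim': "uniform_limit K (\<lambda>i. iter_deriv vs (h i)) (iter_deriv vs f) F" for vs
    using lim K by (simp add: Cinf_loc_tendsto_def)
  have "\<forall>\<^sub>F i in F. \<forall>x\<in>K. dist (h i x) (f x) < d1"
    using uniform_limitD[OF lim'[of "[]"] d1(1)] by simp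
  moreover have "\<forall>\<^sub>F i in F. \<forall>b\<in>Basis. \<forall>x\<in>K. dist (?D (h i) x b) (?D f x b) < d"
    using uniform_limitD[OF lim' \<open>d > 0\<close>, of "[_]"] by (intro eventually_ball_finite) simp_all
  ultimately show ?thesis
  proof eventually_elim
    case (elim i)
    have "dist (h i x) (g x) < e \<and> onorm (\<lambda>v. ?D (h i) x v - ?D g x v) < e" if "x \<in> K" for x
    proof
      have "dist (h i x) (g x) \<le> dist (h i x) (f x) + dist (f x) (g x)" by (rule dist_triangle)
      then show "dist (h i x) (g x) < e" using elim(1) d1(2) that by fastforce
      have "onorm (\<lambda>v. ?D (h i) x v - ?D g x v) =
          onorm (\<lambda>v. (?D (h i) x v - ?D f x v) + (?D f x v - ?D g x v))" by simp
      also have "\<dots> \<le> onorm (\<lambda>v. ?D (h i) x v - ?D f x v) + onorm (\<lambda>v. ?D f x v - ?D g x v)"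
        using h f g by (intro onorm_triangle bl)
      also have "onorm (\<lambda>v. ?D (h i) x v - ?D f x v) \<le> (\<Sum>b\<in>Basis. norm (?D (h i) x b - ?D f x b))"
        using h f by (intro onorm_le_sum_Basis bounded_linear.linear bl)
      also have "\<dots> < (\<Sum>b\<in>(Basis::'a set). d)"
        using elim(2) that by (intro sum_strict_mono) (auto simp: dist_norm)
      also have "\<dots> = d2" by (simp add: d_def)
      finally show "onorm (\<lambda>v. ?D (h i) x v - ?D g x v) < e" using d2(2)[OF that] by linarith
    qed
    then show ?case using h by (simp add: weak_C1_nbhd_def)
  qed
qed

lemma Cinf_loc_tendsto_imp_limitin_weak_C1:
  assumes "\<And>i. Ck 1 (h i)" "Ck 1 f" "Cinf_loc_tendsto h f F"
  shows "limitin weak_C1_topology h f F"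
  unfolding limitin_def
proof (intro conjI allI impI)
  show "f \<in> topspace weak_C1_topology" using assms(2) by (simp add: topspace_weak_C1_topology)
  fix U assume U: "openin weak_C1_topology U \<and> f \<in> U"
  then have "generate_topology_on {weak_C1_nbhd f K e | f K e. Ck 1 f \<and> compact K \<and> 0 < e} U"
    unfolding weak_C1_topology_def by (simp add: openin_topology_generated_by)
  \<comment> \<open>Induction over the generation of \<open>U\<close>: finite intersections and
    unions preserve the claim, so only the generating neighbourhoods need the estimate.\<close>
  then have "f \<in> U \<Longrightarrow> \<forall>\<^sub>F i in F. h i \<in> U"
  proof induction
    case (Int a b)
    then show ?case by (simp add: eventually_conj)
  next
    case (UN K)
    then obtain k where "k \<in> K" "\<forall>\<^sub>F i in F. h i \<in> k" by blast
    then show ?case by (auto elim!: eventually_mono)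
  next
    case (Basis s)
    then show ?case using Cinf_loc_tendsto_imp_eventually_weak_C1_nbhd[OF assms] by blast
  qed simp
  then show "\<forall>\<^sub>F i in F. h i \<in> U" using U by blast
qed

lemma smooth_diffeo_imp_Diff1: "smooth_diffeo f \<Longrightarrow> f \<in> Diff1"
  unfolding smooth_diffeo_def smooth_def Diff1_def by blast

lemma Cinf_loc_tendsto_imp_limitin_Diff1:
  assumes h: "\<And>i. h i \<in> Diff1" and f: "f \<in> Diff1"
    and lim: "Cinf_loc_tendsto h f F" "Cinf_loc_tendsto (\<lambda>i. inv (h i)) (inv f) F"
  shows "limitin Diff1_topology h f F"
proof -
  have "limitin (prod_topology weak_C1_topology weak_C1_topology) (\<lambda>i. (h i, inv (h i))) (f, inv f) F"
    using assms by (simp add: limitin_pairwise comp_def Cinf_loc_tendsto_imp_limitin_weak_C1 Diff1_def)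
  then show ?thesis
    using h f unfolding limitin_def topspace_Diff1_topology
    unfolding Diff1_topology_def openin_pullback_topology by auto
qed

text \<open>The family \<open>a\<close> puts \<open>x\<close> in the closure; were \<open>x\<close>
  an interior point, \<open>b\<close> would eventually enter \<open>S\<close>.\<close>

lemma limitin_imp_frontier_of:
  assumes "limitin X a x F" "F \<noteq> bot" "\<forall>\<^sub>F i in F. a i \<in> S"
    and "limitin X b x G" "G \<noteq> bot" "\<forall>\<^sub>F i in G. b i \<notin> S"
  shows "x \<in> X frontier_of S"
proof -
  have "x \<in> X closure_of S"
    unfolding in_closure_of
  proof (intro conjI allI impI)
    show "x \<in> topspace X" using assms(1) by (simp add: limitin_def)
    fix T assume "x \<in> T \<and> openin X T"
    then have "\<forall>\<^sub>F i in F. a i \<in> T" using assms(1) by (simp add: limitin_def)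
    with assms(3) have "\<forall>\<^sub>F i in F. a i \<in> S \<and> a i \<in> T" by (rule eventually_conj)
    then show "\<exists>y. y \<in> S \<and> y \<in> T" using assms(2) eventually_happens' by blast
  qed
  moreover have "x \<notin> X interior_of S"
  proof
    assume "x \<in> X interior_of S"
    then have "\<forall>\<^sub>F i in G. b i \<in> X interior_of S"
      using assms(4) by (simp add: limitin_def)
    with assms(6) have "\<forall>\<^sub>F i in G. b i \<notin> S \<and> b i \<in> X interior_of S" by (rule eventually_conj)
    then have "\<forall>\<^sub>F i in G. False"
      by (rule eventually_mono) (metis interior_of_subset subsetD)
    then show False using assms(5) by simp
  qed
  ultimately show ?thesis by (simp add: frontier_of_def)
qed


subsection \<open>The Euclidean metric and nonhyperbolic fixed points\<close>

lemma riemannian_metric_inner: "riemannian_metric (\<lambda>x. inner)"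
  unfolding riemannian_metric_def
  by (auto simp: bilinear_conv_bounded_bilinear bounded_bilinear_inner inner_commute smooth_const)

lemma rnorm_inner [simp]: "rnorm (\<lambda>x. inner) x w = norm w"
  by (simp add: rnorm_def norm_eq_sqrt_inner)

text \<open>The fundamental theorem of calculus, in the form that tolerates finitely many
  exceptional parameters, writes the displacement as the integral of the velocity.\<close>

lemma norm_diff_le_length:
  fixes \<gamma> :: "real \<Rightarrow> 'a::euclidean_space"
  assumes \<gamma>: "valid_path \<gamma>"
    and L: "((\<lambda>t. norm (vector_derivative \<gamma> (at t))) has_integral L) {0..1}"
  shows "norm (pathfinish \<gamma> - pathstart \<gamma>) \<le> L"
proof -
  obtain S where S: "finite S" "continuous_on {0..1} \<gamma>"
      "\<And>t. t \<in> {0..1} - S \<Longrightarrow> (\<gamma> has_vector_derivative vector_derivative \<gamma> (at t)) (at t)"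
    using \<gamma> unfolding valid_path_def piecewise_C1_differentiable_on_def C1_differentiable_on_eq
    by (auto simp: vector_derivative_works)
  have int: "((\<lambda>t. vector_derivative \<gamma> (at t)) has_integral (\<gamma> 1 - \<gamma> 0)) {0..1}"
    using S by (intro fundamental_theorem_of_calculus_interior_strong[of S]) auto
  have "norm (integral {0..1} (\<lambda>t. vector_derivative \<gamma> (at t))) \<le>
      integral {0..1} (\<lambda>t. norm (vector_derivative \<gamma> (at t)))"
    using int L by (intro integral_norm_bound_integral) auto
  then show ?thesis
    using int L by (simp add: pathstart_def pathfinish_def integral_unique)
qed

lemma rdist_inner: "rdist (\<lambda>x. inner) x y = dist x (y::'a::euclidean_space)"
proof -
  define S where "S = {L. \<exists>\<gamma>. valid_path \<gamma> \<and> pathstart \<gamma> = x \<and> pathfinish \<gamma> = y \<and>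
     ((\<lambda>t. norm (vector_derivative \<gamma> (at t))) has_integral L) {0..1}}"
  \<comment> \<open>The straight segment attains the lower bound, so the infimum is a
    minimum.\<close>
  have "((\<lambda>t. norm (vector_derivative (linepath x y) (at t))) has_integral dist x y) {0..1}"
    using has_integral_const_real[of "norm (y - x)" 0 1] by (simp add: dist_norm norm_minus_commute)
  then have "dist x y \<in> S"
    unfolding S_def using valid_path_linepath by fastforce
  moreover have "dist x y \<le> L" if "L \<in> S" for L
    using that norm_diff_le_length by (fastforce simp: S_def dist_norm norm_minus_commute)
  ultimately have "Inf S = dist x y" by (rule cInf_eq_minimum)
  then show ?thesis by (simp add: rdist_def S_def)
qed

lemma complete_metric_inner: "complete_metric (\<lambda>x::'a::euclidean_space. inner)"
  unfolding complete_metric_def rdist_inner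
proof (intro allI impI)
  fix \<sigma> :: "nat \<Rightarrow> 'a"
  assume "\<forall>e>0. \<exists>N. \<forall>m\<ge>N. \<forall>n\<ge>N. dist (\<sigma> m) (\<sigma> n) < e"
  then have "Cauchy \<sigma>" by (simp add: Cauchy_def)
  then obtain l where "\<sigma> \<longlonglongrightarrow> l"
    using Cauchy_convergent convergent_def by blast
  then show "\<exists>l. (\<lambda>n. dist (\<sigma> n) l) \<longlonglongrightarrow> 0" using tendsto_dist_iff by blast
qed

section \<open>Fixed points of Anosov diffeomorphisms\<close>

lemma has_derivative_funpow_fixpoint:
  assumes "(f has_derivative D) (at x)" "f x = x"
  shows "((f ^^ m) has_derivative (D ^^ m)) (at x)" and "(f ^^ m) x = x"
proof -
  show fp: "(f ^^ m) x = x" for m using assms(2) by (induction m) auto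
  show "((f ^^ m) has_derivative (D ^^ m)) (at x)"
  proof (induction m)
    case 0
    then show ?case by (simp add: id_def)
  next
    case (Suc m)
    then show ?case using diff_chain_at[OF Suc, of f D] assms(1) fp[of m] by (simp add: comp_def)
  qed
qed

text \<open>The derivative of every iterate fixes \<open>w\<close>, so a nonzero \<open>w\<close>
  would give \<open>1 \<le> C * l ^ m\<close> for all \<open>m\<close>. It serves for
  \<open>f\<close> on the stable and for \<open>inv f\<close> on the unstable subspace.\<close>

lemma anosov_wrt_fixpoint_contracting:
  assumes \<rho>: "riemannian_metric \<rho>" and D: "(f has_derivative D) (at x)" "f x = x" "D w = w"
    and C: "1 \<le> C" "0 < l" "l < 1"
    and le: "\<And>m. rnorm \<rho> ((f ^^ m) x) (frechet_derivative (f ^^ m) (at x) w) \<le> C * l ^ m * rnorm \<rho> x w"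
  shows "w = 0"
proof (rule ccontr)
  assume "w \<noteq> 0"
  then have pos: "rnorm \<rho> x w > 0" using \<rho> by (simp add: riemannian_metric_def rnorm_def)
  have "(D ^^ m) w = w" for m using D(3) by (induction m) auto
  then have "rnorm \<rho> x w \<le> C * l ^ m * rnorm \<rho> x w" for m
    using le[of m] has_derivative_funpow_fixpoint[OF D(1,2), of m] by (simp add: frechet_derivative_eqI)
  then have "1 \<le> C * l ^ m" for m using pos by simp
  moreover have "(\<lambda>m. C * l ^ m) \<longlonglongrightarrow> C * 0"
    using C by (intro tendsto_intros LIMSEQ_power_zero) auto
  ultimately show False using LIMSEQ_le_const[of "\<lambda>m. C * l ^ m" "C * 0" 1] by auto
qed

lemma continuous_subbundle_imp_subspace:
  assumes "continuous_subbundle E"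
  shows "subspace (E x)"
proof -
  have "\<exists>B. span B = E x"
    using spec[OF assms[unfolded continuous_subbundle_def], of x] by blast
  then obtain B where "span B = E x" ..
  then show ?thesis using subspace_span[of B] by simp
qed

text \<open>The stable and unstable components of an invariant vector are themselves invariant. The
  first is contracted by the iterates of \<open>f\<close>, the second by those of
  \<open>inv f\<close>, so both vanish.\<close>

lemma anosov_diffs_fixpoint_no_invariant_vector:
  assumes f: "f \<in> anosov_diffs" and x: "f x = x" and D: "(f has_derivative D) (at x)" and k: "D k = k"
  shows "k = 0"
proof -
  obtain \<rho> Es Eu C l where f1: "f \<in> Diff1" and \<rho>: "riemannian_metric \<rho>"
    and inv_spl: "invariant_splitting f Es Eu" and C: "1 \<le> C" "0 < l" "l < 1"
    and s: "\<And>m x w. w \<in> Es x \<Longrightarrow>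
      rnorm \<rho> ((f ^^ m) x) (frechet_derivative (f ^^ m) (at x) w) \<le> C * l ^ m * rnorm \<rho> x w"
    and u: "\<And>m x w. w \<in> Eu x \<Longrightarrow>
      rnorm \<rho> ((inv f ^^ m) x) (frechet_derivative (inv f ^^ m) (at x) w) \<le> C * l ^ m * rnorm \<rho> x w"
    using f unfolding anosov_diffs_def anosov_wrt_def by blast
  have DD: "frechet_derivative f (at x) = D" using D by (rule frechet_derivative_eqI)
  have cap: "Es x \<inter> Eu x = {0}" and sum: "{a + b | a b. a \<in> Es x \<and> b \<in> Eu x} = UNIV"
    using inv_spl unfolding invariant_splitting_def by simp_all
  have "frechet_derivative f (at x) ` Es x = Es (f x)" "frechet_derivative f (at x) ` Eu x = Eu (f x)"
    using inv_spl unfolding invariant_splitting_def by simp_all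
  then have Es: "D ` Es x = Es x" and Eu: "D ` Eu x = Eu x" by (simp_all add: x DD)
  have sub: "subspace (Es x)" "subspace (Eu x)"
    using inv_spl unfolding invariant_splitting_def by (simp_all add: continuous_subbundle_imp_subspace)
  obtain a b where ab: "a \<in> Es x" "b \<in> Eu x" "k = a + b" using sum by blast
  have "D a + D b = a + b"
    using k ab(3) linear_add[OF has_derivative_linear[OF D]] by simp
  \<comment> \<open>The two sides lie in the stable and the unstable subspace, which meet only in
    0.\<close>
  then have eq: "D a - a = b - D b" by (simp add: algebra_simps)
  have "D a \<in> Es x" "D b \<in> Eu x" using ab(1,2) Es Eu by (metis imageI)+
  then have "D a - a \<in> Es x" "b - D b \<in> Eu x" using ab(1,2) sub by (simp_all add: subspace_diff)
  then have "D a - a = 0" using eq cap by (metis IntI singletonD)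
  then have Da: "D a = a" and Db: "D b = b" using eq by simp_all
  have bij: "bij f" and diff: "inv f differentiable (at x)"
    using f1 by (auto simp: Diff1_def)
  have inv_x: "inv f x = x" using bij x by (metis bij_inv_eq_iff)
  let ?D' = "frechet_derivative (inv f) (at x)"
  have D': "(inv f has_derivative ?D') (at x)" using diff frechet_derivative_works by blast
  then have "((inv f \<circ> f) has_derivative (?D' \<circ> D)) (at x)"
    using D x by (intro diff_chain_at) auto
  moreover have "inv f \<circ> f = id" using bij by (simp add: bij_is_inj)
  ultimately have "?D' \<circ> D = id"
    by (metis has_derivative_id has_derivative_unique)
  then have D'b: "?D' b = b" using Db by (metis comp_apply id_apply)
  have "a = 0" using anosov_wrt_fixpoint_contracting[OF \<rho> D x Da C] s ab(1) by blast
  moreover have "b = 0" using anosov_wrt_fixpoint_contracting[OF \<rho> D' inv_x D'b C] u ab(2) by blast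
  ultimately show "k = 0" using ab(3) by simp
qed


subsection \<open>Linear recurrences\<close>

text \<open>The polynomial acts on two-sided sequences with the indeterminate acting as the shift. A
  sequence solves the linear recurrence with characteristic polynomial \<open>p\<close> iff the
  result is 0.\<close>

definition shift_poly :: "complex poly \<Rightarrow> (int \<Rightarrow> complex) \<Rightarrow> int \<Rightarrow> complex" where
  "shift_poly p x m = (\<Sum>j\<le>degree p. coeff p j * x (m + int j))"

lemma shift_poly_eq_sum:
  assumes "degree p \<le> N"
  shows "shift_poly p x m = (\<Sum>j\<le>N. coeff p j * x (m + int j))"
  unfolding shift_poly_def
  by (rule sum.mono_neutral_left) (use assms in \<open>auto simp: coeff_eq_0\<close>)

lemma shift_poly_0 [simp]: "shift_poly 0 x m = 0"
  by (simp add: shift_poly_def)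

lemma shift_poly_zero [simp]: "shift_poly p (\<lambda>m. 0) m = 0"
  by (simp add: shift_poly_def)

lemma shift_poly_add: "shift_poly (p + q) x m = shift_poly p x m + shift_poly q x m"
proof -
  let ?N = "max (degree p) (degree q)"
  have "degree (p + q) \<le> ?N" by (simp add: degree_add_le)
  then show ?thesis
    by (simp add: shift_poly_eq_sum[of _ ?N] sum.distrib distrib_right)
qed

lemma shift_poly_smult: "shift_poly (smult c p) x m = c * shift_poly p x m"
  by (simp add: shift_poly_eq_sum[of _ "degree p"] sum_distrib_left mult.assoc)

lemma shift_poly_pCons: "shift_poly (pCons a p) x m = a * x m + shift_poly p x (m + 1)"
proof -
  have "shift_poly (pCons a p) x m = (\<Sum>j\<le>Suc (degree p). coeff (pCons a p) j * x (m + int j))"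
    by (rule shift_poly_eq_sum) (simp add: degree_pCons_le)
  also have "\<dots> = a * x m + (\<Sum>j\<le>degree p. coeff p j * x (m + int (Suc j)))"
    by (subst sum.atMost_Suc_shift) simp
  finally show ?thesis by (simp add: shift_poly_def add.assoc)
qed

text \<open>Together with additivity this makes the sequences a module over the polynomials, so that
  factorisations and Bezout identities can be applied to orbits.\<close>

lemma shift_poly_mult: "shift_poly (p * q) x = shift_poly p (shift_poly q x)"
proof (induction p)
  case (pCons a p)
  then show ?case by (auto simp: shift_poly_add shift_poly_smult shift_poly_pCons)
qed auto

lemma shift_poly_linear_factor: "shift_poly [:-z, 1:] x m = x (m + 1) - z * x m"
  by (simp add: shift_poly_pCons)

text \<open>A multiset keeps multiplicities, and induction over it peels off one first-order
  recurrence at a time.\<close>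

definition roots_poly :: "complex multiset \<Rightarrow> complex poly" where
  "roots_poly Z = (\<Prod>z\<in>#Z. [:-z, 1:])"

lemma roots_poly_empty: "shift_poly (roots_poly {#}) x = x"
  by (auto simp: roots_poly_def one_pCons shift_poly_pCons)

lemma roots_poly_add_mset:
  "shift_poly (roots_poly (add_mset z Z)) x =
    shift_poly (roots_poly Z) (\<lambda>m. x (m + 1) - z * x m)"
proof -
  have "roots_poly (add_mset z Z) = roots_poly Z * [:-z, 1:]"
    unfolding roots_poly_def by (simp only: image_mset_add_mset prod_mset.add_mset mult.commute)
  moreover have "shift_poly [:-z, 1:] x = (\<lambda>m. x (m + 1) - z * x m)"
    by (auto simp: shift_poly_linear_factor)
  ultimately show ?thesis by (simp only: shift_poly_mult)
qed

text \<open>Applying the factor of one root \<open>z\<close> gives a sequence \<open>y\<close> that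
  decays by induction, and \<open>x\<close> is recovered from
  \<open>x (m + 1) = z * x m + y m\<close>. As \<open>cmod z\<close> is strictly below
  \<open>l\<close>, repeated roots cost no polynomial factor.\<close>

lemma forward_decay:
  assumes "shift_poly (roots_poly Z) x = (\<lambda>m. 0)" "\<And>z. z \<in># Z \<Longrightarrow> cmod z < l"
  shows "\<exists>C. \<forall>m. cmod (x (int m)) \<le> C * l ^ m"
  using assms
proof (induction Z arbitrary: x)
  case empty
  then show ?case by (auto simp: roots_poly_empty intro: exI[of _ 0])
next
  case (add z Z)
  define y where "y = (\<lambda>m. x (m + 1) - z * x m)"
  have "shift_poly (roots_poly Z) y = (\<lambda>m. 0)"
    using add.prems(1) by (simp add: roots_poly_add_mset y_def)
  then obtain C where C: "\<And>m. cmod (y (int m)) \<le> C * l ^ m" using add by fastforce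
  have zl: "cmod z < l" using add.prems(2) by simp
  then have l: "l > 0" by (meson le_less_trans norm_ge_zero)
  \<comment> \<open>The quotient ensures \<open>cmod z * C' + C \<le> l * C'\<close>, which closes
    the induction step; the other entry of the maximum covers \<open>m = 0\<close>.\<close>
  define C' where "C' = max (cmod (x 0)) (C / (l - cmod z))"
  have C': "C \<le> C' * (l - cmod z)"
    using zl by (simp add: C'_def flip: pos_divide_le_eq)
  have "cmod (x (int m)) \<le> C' * l ^ m" for m
  proof (induction m)
    case 0
    then show ?case by (simp add: C'_def)
  next
    case (Suc m)
    have "x (int (Suc m)) = z * x (int m) + y (int m)" by (simp add: y_def add.commute)
    then have "cmod (x (int (Suc m))) \<le> cmod z * cmod (x (int m)) + cmod (y (int m))"
      by (metis norm_mult norm_triangle_ineq)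
    also have "\<dots> \<le> cmod z * (C' * l ^ m) + C' * (l - cmod z) * l ^ m"
      using order_trans[OF C[of m] mult_right_mono[OF C', of "l ^ m"]] l Suc
      by (intro add_mono mult_left_mono) auto
    also have "\<dots> = C' * l ^ Suc m" by (simp add: algebra_simps)
    finally show ?case .
  qed
  then show ?case by blast
qed

text \<open>The same peeling, with the first-order recurrence solved for the earlier term; now a
  root outside the circle of radius \<open>l\<close> is what contracts.\<close>

lemma backward_decay:
  assumes "shift_poly (roots_poly Z) x = (\<lambda>m. 0)" "\<And>z. z \<in># Z \<Longrightarrow> l < cmod z" "0 < l"
  shows "\<exists>C. \<forall>m. cmod (x (- int m)) \<le> C * (1 / l) ^ m"
  using assms
proof (induction Z arbitrary: x)
  case empty
  then show ?case by (auto simp: roots_poly_empty intro: exI[of _ 0])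
next
  case (add z Z)
  define y where "y = (\<lambda>m. x (m + 1) - z * x m)"
  have "shift_poly (roots_poly Z) y = (\<lambda>m. 0)"
    using add.prems(1) by (simp add: roots_poly_add_mset y_def)
  then obtain C where C: "\<And>m. cmod (y (- int m)) \<le> C * (1 / l) ^ m" using add by fastforce
  have zl: "l < cmod z" using add.prems(2) by simp
  have l: "l > 0" by fact
  define C' where "C' = max (cmod (x 0)) (C / (cmod z - l))"
  have C': "C \<le> C' * (cmod z - l)"
    using zl by (simp add: C'_def flip: pos_divide_le_eq)
  have "cmod (x (- int m)) \<le> C' * (1 / l) ^ m" for m
  proof (induction m)
    case 0
    then show ?case by (simp add: C'_def)
  next
    case (Suc m)
    have "z * x (- int (Suc m)) = x (- int m) - y (- int (Suc m))" by (simp add: y_def)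
    then have "cmod z * cmod (x (- int (Suc m))) \<le> cmod (x (- int m)) + cmod (y (- int (Suc m)))"
      by (metis norm_mult norm_triangle_ineq4)
    also have "\<dots> \<le> C' * (1 / l) ^ m + C' * (cmod z - l) * (1 / l) ^ Suc m"
      using order_trans[OF C[of "Suc m"] mult_right_mono[OF C', of "(1 / l) ^ Suc m"]] l Suc
      by (intro add_mono) auto
    \<comment> \<open>Since \<open>(1 / l) ^ m\<close> equals \<open>l * (1 / l) ^ Suc m\<close>,
      the two multiples of \<open>l\<close> cancel.\<close>
    also have "\<dots> = cmod z * (C' * (1 / l) ^ Suc m)" using l by (simp add: field_simps)
    finally have "cmod z * cmod (x (- int (Suc m))) \<le> cmod z * (C' * (1 / l) ^ Suc m)" .
    then show ?case by (rule mult_left_le_imp_le) (use zl l in linarith)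
  qed
  then show ?case by blast
qed

text \<open>After one root \<open>z\<close> is peeled off, induction leaves the zero sequence, so
  \<open>x\<close> is geometric with ratio \<open>z\<close>. If nonzero, it exceeds the bound
  towards the past when \<open>cmod z < r\<close> and towards the future when
  \<open>cmod z > r\<close>.\<close>

lemma bounded_solution_eq_0:
  assumes "shift_poly (roots_poly Z) x = (\<lambda>m. 0)" "\<And>z. z \<in># Z \<Longrightarrow> cmod z \<noteq> r" "0 < r"
    and "\<And>m. cmod (x m) \<le> C * r powi m"
  shows "x = (\<lambda>m. 0)"
  using assms
proof (induction Z arbitrary: x C)
  case empty
  then show ?case by (simp add: roots_poly_empty)
next
  case (add z Z)
  define y where "y = (\<lambda>m. x (m + 1) - z * x m)"
  have r: "0 < r" and zr: "cmod z \<noteq> r" using add.prems by auto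
  have "cmod (y m) \<le> (C * r + cmod z * C) * r powi m" for m
  proof -
    have "cmod (y m) \<le> cmod (x (m + 1)) + cmod z * cmod (x m)"
      unfolding y_def by (metis norm_mult norm_triangle_ineq4)
    also have "\<dots> \<le> C * r powi (m + 1) + cmod z * (C * r powi m)"
      by (intro add_mono mult_left_mono add.prems) simp
    also have "\<dots> = (C * r + cmod z * C) * r powi m"
      using r by (simp add: power_int_add algebra_simps)
    finally show ?thesis .
  qed
  moreover have "shift_poly (roots_poly Z) y = (\<lambda>m. 0)"
    using add.prems(1) by (simp add: roots_poly_add_mset y_def)
  ultimately have "y = (\<lambda>m. 0)" using add.IH r add.prems(2) by (metis union_single_eq_member add_mset_commute insert_iff set_mset_add_mset_insert)
  then have step: "x (m + 1) = z * x m" for m by (metis eq_iff_diff_eq_0 y_def)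
  have fwd: "x (m + int n) = z ^ n * x m" for m n
  proof (induction n)
    case (Suc n)
    then show ?case using step[of "m + int n"] by (simp add: ac_simps)
  qed simp
  have "x m = 0" for m
  proof (rule ccontr)
    assume x: "x m \<noteq> 0"
    show False
    proof (cases "cmod z < r")
      case True
      have bound: "cmod (x m) \<le> C * r powi m * (cmod z / r) ^ n" for n
      proof -
        have "cmod (x m) = cmod z ^ n * cmod (x (m - int n))"
          using fwd[of "m - int n" n] by (simp add: norm_mult norm_power)
        also have "\<dots> \<le> cmod z ^ n * (C * r powi (m - int n))"
          by (intro mult_left_mono add.prems) simp
        also have "\<dots> = C * r powi m * (cmod z / r) ^ n"
          using r by (simp add: power_int_diff power_divide)
        finally show ?thesis .
      qed
      have "(\<lambda>n. C * r powi m * (cmod z / r) ^ n) \<longlonglongrightarrow> C * r powi m * 0"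
        using True r by (intro tendsto_intros LIMSEQ_power_zero) simp
      then have "cmod (x m) \<le> C * r powi m * 0" by (rule LIMSEQ_le_const) (use bound in blast)
      then show False using x by simp
    next
      case False
      then have z: "cmod z > r" using zr by simp
      have bound: "cmod (x m) \<le> C * r powi m * (r / cmod z) ^ n" for n
      proof -
        have "cmod z ^ n * cmod (x m) = cmod (x (m + int n))"
          using fwd[of m n] by (simp add: norm_mult norm_power)
        also have "\<dots> \<le> C * r powi (m + int n)" by (rule add.prems)
        also have "\<dots> = C * r powi m * r ^ n" using r by (simp add: power_int_add)
        finally have "cmod z ^ n * cmod (x m) \<le> C * r powi m * r ^ n" .
        moreover have "cmod z ^ n > 0" using z r by (intro zero_less_power) linarith
        ultimately show ?thesis by (simp add: power_divide pos_le_divide_eq mult.commute)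
      qed
      have "(\<lambda>n. C * r powi m * (r / cmod z) ^ n) \<longlonglongrightarrow> C * r powi m * 0"
        using z less_trans[OF r z] r by (intro tendsto_intros LIMSEQ_power_zero) simp
      then have "cmod (x m) \<le> C * r powi m * 0" by (rule LIMSEQ_le_const) (use bound in blast)
      then show False using x by simp
    qed
  qed
  then show ?case by blast
qed

section \<open>Bezout identities between products of linear factors\<close>

lemma comaximal_mult:
  fixes p q r :: "'a::comm_ring_1"
  assumes "\<exists>a b. a * p + b * r = 1" "\<exists>a b. a * q + b * r = 1"
  shows "\<exists>a b. a * (p * q) + b * r = 1"
proof -
  obtain a b c d where "a * p + b * r = 1" "c * q + d * r = 1" using assms by blast
  then have "(a * p + b * r) * (c * q + d * r) = 1" by simp
  \<comment> \<open>In the product of the two identities every term other than this one contains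
    \<open>r\<close>.\<close>
  then have "(a * c) * (p * q) + (a * p * d + b * c * q + b * d * r) * r = 1"
    by (simp add: algebra_simps)
  then show ?thesis by blast
qed

text \<open>Linear factors with distinct roots are comaximal, and comaximality passes to products:
  first over the roots in \<open>W\<close>, then over those in \<open>Z\<close>.\<close>

lemma comaximal_roots_poly:
  assumes "set_mset Z \<inter> set_mset W = {}"
  shows "\<exists>a b. a * roots_poly Z + b * roots_poly W = 1"
proof -
  have comm: "\<exists>a b. a * p + b * q = 1" if "\<exists>a b. a * q + b * p = 1" for p q :: "complex poly"
    using that by (metis add.commute)
  have rp_add: "roots_poly (add_mset z V) = [:-z, 1:] * roots_poly V" for z V
    unfolding roots_poly_def by (simp only: image_mset_add_mset prod_mset.add_mset)
  have rp_empty: "roots_poly {#} = 1" by (simp add: roots_poly_def)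
  have lin: "\<exists>a b. a * [:-z, 1:] + b * [:-w, 1:] = 1" if "z \<noteq> w" for z w :: complex
  proof (intro exI)
    \<comment> \<open>The difference of the two linear factors is the constant
      \<open>w - z\<close>.\<close>
    show "[:1 / (w - z):] * [:-z, 1:] + [:- 1 / (w - z):] * [:-w, 1:] = 1"
      using that by (simp add: one_pCons divide_simps)
  qed
  have lin_roots: "\<exists>a b. a * roots_poly W + b * [:-z, 1:] = 1" if "z \<notin># W" for z W
    using that
  proof (induction W)
    case empty
    show ?case by (rule exI[of _ 1], rule exI[of _ 0]) (simp add: rp_empty)
  next
    case (add w W)
    then show ?case unfolding rp_add
      by (intro comaximal_mult lin) auto
  qed
  show ?thesis using assms
  proof (induction Z)
    case empty
    show ?case by (rule exI[of _ 1], rule exI[of _ 0]) (simp add: rp_empty)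
  next
    case (add z Z)
    then show ?case unfolding rp_add
      by (intro comaximal_mult comm[OF lin_roots]) auto
  qed
qed


section \<open>Subspaces of exponentially decaying vectors\<close>

lemma linear_funpow:
  fixes M :: "'a::real_vector \<Rightarrow> 'a"
  shows "linear M \<Longrightarrow> linear (M ^^ n)"
  by (induction n) (auto simp: linear_id linear_compose simp flip: id_def)

text \<open>The constant may depend on \<open>w\<close>, so closure under addition and scaling is
  immediate; \<open>decay_space_uniform\<close> recovers a common constant.\<close>

definition decay_space :: "('a::real_normed_vector \<Rightarrow> 'a) \<Rightarrow> real \<Rightarrow> 'a set" where
  "decay_space M l = {w. \<exists>C. \<forall>m. norm ((M ^^ m) w) \<le> C * l ^ m}"

lemma subspace_decay_space:
  assumes M: "linear M"
  shows "subspace (decay_space M l)"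
proof (rule subspaceI)
  note lin = linear_funpow[OF M]
  show "0 \<in> decay_space M l"
    by (auto simp: decay_space_def linear_0[OF lin] intro: exI[of _ 0])
  show "x + y \<in> decay_space M l" if xy: "x \<in> decay_space M l" "y \<in> decay_space M l" for x y
  proof -
    obtain C D where "\<And>m. norm ((M ^^ m) x) \<le> C * l ^ m" "\<And>m. norm ((M ^^ m) y) \<le> D * l ^ m"
      using xy by (auto simp: decay_space_def)
    then have "norm ((M ^^ m) (x + y)) \<le> (C + D) * l ^ m" for m
      unfolding linear_add[OF lin] distrib_right by (intro norm_triangle_mono)
    then show ?thesis by (auto simp: decay_space_def)
  qed
  show "c *\<^sub>R x \<in> decay_space M l" if x: "x \<in> decay_space M l" for c x
  proof -
    obtain C where "\<And>m. norm ((M ^^ m) x) \<le> C * l ^ m"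
      using x by (auto simp: decay_space_def)
    then have "norm ((M ^^ m) (c *\<^sub>R x)) \<le> (\<bar>c\<bar> * C) * l ^ m" for m
      by (simp add: linear_scale[OF lin] mult.assoc mult_left_mono)
    then show ?thesis by (auto simp: decay_space_def)
  qed
qed

lemma image_decay_space:
  assumes MN: "\<And>x. M (N x) = x" and l: "0 < l"
  shows "M ` decay_space M l = decay_space M l"
proof
  show "M ` decay_space M l \<subseteq> decay_space M l"
  proof
    fix y assume "y \<in> M ` decay_space M l"
    then obtain w C where y: "y = M w" and C: "\<And>m. norm ((M ^^ m) w) \<le> C * l ^ m"
      by (auto simp: decay_space_def)
    have "norm ((M ^^ m) y) \<le> (C * l) * l ^ m" for m
      using C[of "Suc m"] by (simp add: y funpow_swap1 mult.assoc)
    then show "y \<in> decay_space M l" by (auto simp: decay_space_def)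
  qed
  show "decay_space M l \<subseteq> M ` decay_space M l"
  proof
    fix w assume "w \<in> decay_space M l"
    then obtain C where C: "\<And>m. norm ((M ^^ m) w) \<le> C * l ^ m"
      by (auto simp: decay_space_def)
    \<comment> \<open>Passing to \<open>N w\<close> prepends one term to the orbit of
      \<open>w\<close>: the maximum covers that term, and \<open>C / l\<close> pays for the shift of
      index.\<close>
    have "norm ((M ^^ m) (N w)) \<le> max (norm (N w)) (C / l) * l ^ m" for m
    proof (cases m)
      case (Suc k)
      have "norm ((M ^^ m) (N w)) = norm ((M ^^ k) w)"
        using MN by (simp add: Suc funpow_swap1)
      also have "\<dots> \<le> C / l * l ^ m" using C[of k] l by (simp add: Suc)
      also have "\<dots> \<le> max (norm (N w)) (C / l) * l ^ m" using l by (intro mult_right_mono) auto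
      finally show ?thesis .
    qed simp
    then have "N w \<in> decay_space M l" by (auto simp: decay_space_def)
    then show "w \<in> M ` decay_space M l" using MN by (metis imageI)
  qed
qed

text \<open>In finite dimension the constants of an orthonormal basis can be added up, since the
  coordinates of \<open>w\<close> are at most \<open>norm w\<close>.\<close>

lemma decay_space_uniform:
  fixes M :: "'a::euclidean_space \<Rightarrow> 'a"
  assumes M: "linear M" and l: "0 < l"
  shows "\<exists>C\<ge>1. \<forall>w\<in>decay_space M l. \<forall>m. norm ((M ^^ m) w) \<le> C * l ^ m * norm w"
proof -
  obtain B where B: "B \<subseteq> decay_space M l" "pairwise orthogonal B" "\<And>x. x \<in> B \<Longrightarrow> norm x = 1"
      "independent B" "span B = decay_space M l"
    using orthonormal_basis_subspace[OF subspace_decay_space[OF M]] by metis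
  have fin: "finite B" using B(4) by (rule independent_imp_finite)
  have "\<forall>b\<in>B. \<exists>C. \<forall>m. norm ((M ^^ m) b) \<le> C * l ^ m"
    using B(1) by (auto simp: decay_space_def)
  then obtain K where K: "\<And>b m. b \<in> B \<Longrightarrow> norm ((M ^^ m) b) \<le> K b * l ^ m" by metis
  have K0: "0 \<le> K b" if "b \<in> B" for b
    using order_trans[OF norm_ge_zero K[OF that, of 0]] by simp
  \<comment> \<open>The summand 1 keeps the constant at least 1, as \<open>anosov_wrt\<close>
    demands, even for an empty basis.\<close>
  have "norm ((M ^^ m) w) \<le> (1 + sum K B) * l ^ m * norm w" if w: "w \<in> decay_space M l" for w m
  proof -
    have "w = (\<Sum>b\<in>B. (w \<bullet> b) *\<^sub>R b)"
      using orthonormal_basis_expand[OF B(2,3) _ fin] w B(5) by metis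
    then have "(M ^^ m) w = (\<Sum>b\<in>B. (w \<bullet> b) *\<^sub>R (M ^^ m) b)"
      using linear_funpow[OF M, of m] by (metis (no_types, lifting) linear_scale linear_sum sum.cong)
    also have "norm \<dots> \<le> (\<Sum>b\<in>B. norm w * (K b * l ^ m))"
    proof (rule sum_norm_le)
      fix b assume b: "b \<in> B"
      have "\<bar>w \<bullet> b\<bar> \<le> norm w" using Cauchy_Schwarz_ineq2[of w b] B(3)[OF b] by simp
      then show "norm ((w \<bullet> b) *\<^sub>R (M ^^ m) b) \<le> norm w * (K b * l ^ m)"
        using K[OF b, of m] by (simp add: mult_mono)
    qed
    also have "\<dots> = sum K B * (l ^ m * norm w)"
      unfolding sum_distrib_right by (intro sum.cong) auto
    also have "\<dots> \<le> (1 + sum K B) * (l ^ m * norm w)" using l by (intro mult_right_mono) auto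
    finally show ?thesis by (simp add: mult.assoc)
  qed
  moreover have "1 \<le> 1 + sum K B" using K0 by (simp add: sum_nonneg)
  ultimately show ?thesis by blast
qed


subsection \<open>Hyperbolic splittings\<close>

locale linear_iso =
  fixes M N :: "'a::euclidean_space \<Rightarrow> 'a"
  assumes M: "linear M" and N: "linear N"
    and MN: "\<And>x. M (N x) = x" and NM: "\<And>x. N (M x) = x"
begin

definition int_iter :: "int \<Rightarrow> 'a \<Rightarrow> 'a" where
  "int_iter m w = (if 0 \<le> m then (M ^^ nat m) w else (N ^^ nat (- m)) w)"

text \<open>The values are real but are regarded as complex, so that the recurrence can be factored
  into linear factors.\<close>

definition orbit_coord :: "'a \<Rightarrow> 'a \<Rightarrow> int \<Rightarrow> complex" where
  "orbit_coord u w m = complex_of_real (u \<bullet> int_iter m w)"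

lemma int_iter_of_nat [simp]: "int_iter (int m) = M ^^ m"
  by (auto simp: int_iter_def)

lemma int_iter_minus_of_nat [simp]: "int_iter (- int m) = N ^^ m"
  by (auto simp: int_iter_def)

lemma linear_int_iter: "linear (int_iter m)"
proof (cases "0 \<le> m")
  case True
  then show ?thesis using linear_funpow[OF M] by (simp add: int_iter_def[abs_def])
next
  case False
  then show ?thesis using linear_funpow[OF N] by (simp add: int_iter_def[abs_def])
qed

lemma int_iter_plus_1: "int_iter (m + 1) w = M (int_iter m w)"
proof (cases "0 \<le> m")
  case True
  then show ?thesis by (simp add: int_iter_def nat_add_distrib)
next
  case False
  then obtain k where "m = - int (Suc k)" by (cases m rule: int_cases) auto
  moreover from this have "m + 1 = - int k" by simp
  ultimately show ?thesis by (simp only: int_iter_minus_of_nat) (simp add: MN)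
qed

lemma int_iter_plus_nat: "int_iter (m + int j) w = (M ^^ j) (int_iter m w)"
proof (induction j)
  case (Suc j)
  then show ?case using int_iter_plus_1[of "m + int j" w] by (simp add: ac_simps)
qed simp

lemma int_iter_funpow: "int_iter m ((M ^^ j) w) = (M ^^ j) (int_iter m w)"
proof -
  have 1: "(M ^^ k) (M w) = M ((M ^^ k) w)" for k w by (simp add: funpow_swap1)
  have 2: "(N ^^ k) (M w) = M ((N ^^ k) w)" for k w
    by (induction k) (simp_all add: MN NM)
  have "int_iter m (M w) = M (int_iter m w)" for w
    by (simp add: int_iter_def 1 2)
  then show ?thesis by (induction j) simp_all
qed

text \<open>The Bezout coefficients are complex while the space is real. As orbit coordinates are
  real, taking real parts of the coefficients amounts to taking the real part of
  \<open>shift_poly\<close>.\<close>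

definition poly_map :: "complex poly \<Rightarrow> 'a \<Rightarrow> 'a" where
  "poly_map q w = (\<Sum>j\<le>degree q. Re (coeff q j) *\<^sub>R (M ^^ j) w)"

lemma inner_int_iter_poly_map:
  "u \<bullet> int_iter m (poly_map q w) = Re (shift_poly q (orbit_coord u w) m)"
proof -
  have "u \<bullet> int_iter m (poly_map q w) =
      (\<Sum>j\<le>degree q. Re (coeff q j) * (u \<bullet> int_iter (m + int j) w))"
    by (simp add: poly_map_def linear_sum[OF linear_int_iter] linear_scale[OF linear_int_iter]
        inner_sum_right int_iter_funpow int_iter_plus_nat)
  also have "\<dots> = Re (shift_poly q (orbit_coord u w) m)"
    by (simp add: shift_poly_def orbit_coord_def)
  finally show ?thesis .
qed

lemma funpow_poly_map_decay:
  assumes p: "shift_poly (roots_poly Z) (shift_poly q (orbit_coord u w)) = (\<lambda>m. 0)"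
    and Z: "\<And>z. z \<in># Z \<Longrightarrow> cmod z < l"
  shows "\<exists>C. \<forall>m. \<bar>u \<bullet> (M ^^ m) (poly_map q w)\<bar> \<le> C * l ^ m"
proof -
  have le: "\<bar>u \<bullet> (M ^^ m) (poly_map q w)\<bar> \<le> cmod (shift_poly q (orbit_coord u w) (int m))" for m
    using inner_int_iter_poly_map[of u "int m" q w] by (simp add: abs_Re_le_cmod)
  show ?thesis using forward_decay[OF p Z] le by (meson order_trans)
qed

lemma funpow_inverse_poly_map_decay:
  assumes p: "shift_poly (roots_poly Z) (shift_poly q (orbit_coord u w)) = (\<lambda>m. 0)"
    and Z: "\<And>z. z \<in># Z \<Longrightarrow> l < cmod z" "0 < l"
  shows "\<exists>C. \<forall>m. \<bar>u \<bullet> (N ^^ m) (poly_map q w)\<bar> \<le> C * (1 / l) ^ m"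
proof -
  have le: "\<bar>u \<bullet> (N ^^ m) (poly_map q w)\<bar> \<le> cmod (shift_poly q (orbit_coord u w) (- int m))" for m
    using inner_int_iter_poly_map[of u "- int m" q w] by (simp add: abs_Re_le_cmod)
  show ?thesis using backward_decay[OF p Z] le by (meson order_trans)
qed

end

lemma in_decay_spaceI:
  fixes M :: "'a::euclidean_space \<Rightarrow> 'a"
  assumes "\<And>u. \<exists>C. \<forall>m. \<bar>u \<bullet> (M ^^ m) w\<bar> \<le> C * l ^ m"
  shows "w \<in> decay_space M l"
proof -
  obtain K where K: "\<And>u m. \<bar>u \<bullet> (M ^^ m) w\<bar> \<le> K u * l ^ m" using assms by metis
  have "norm ((M ^^ m) w) \<le> (\<Sum>b\<in>Basis. K b) * l ^ m" for m
  proof -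
    have "norm ((M ^^ m) w) \<le> (\<Sum>b\<in>Basis. \<bar>(M ^^ m) w \<bullet> b\<bar>)" by (rule norm_le_l1)
    also have "\<dots> \<le> (\<Sum>b\<in>Basis. K b * l ^ m)"
      using K by (intro sum_mono) (simp add: inner_commute)
    finally show ?thesis by (simp add: sum_distrib_right)
  qed
  then show ?thesis by (auto simp: decay_space_def)
qed

context linear_iso
begin

text \<open>For a vector in both spaces the whole two-sided orbit is bounded by a multiple of
  \<open>r powi m\<close>, and \<open>bounded_solution_eq_0\<close> makes it vanish.\<close>

lemma decay_spaces_disjoint:
  assumes ann: "\<And>u w. shift_poly (roots_poly Z) (orbit_coord u w) = (\<lambda>m. 0)"
    and Z: "\<And>z. z \<in># Z \<Longrightarrow> cmod z \<noteq> r"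
    and l: "0 < l1" "l1 < r" "r < l2"
  shows "decay_space M l1 \<inter> decay_space N (1 / l2) = {0}"
proof -
  have "w = 0" if w: "w \<in> decay_space M l1" "w \<in> decay_space N (1 / l2)" for w
  proof -
    obtain C D where C: "\<And>m. norm ((M ^^ m) w) \<le> C * l1 ^ m"
      and D: "\<And>m. norm ((N ^^ m) w) \<le> D * (1 / l2) ^ m"
      using w by (auto simp: decay_space_def)
    have CD: "0 \<le> C" "0 \<le> D"
      using order_trans[OF norm_ge_zero C[of 0]] order_trans[OF norm_ge_zero D[of 0]] by auto
    have r: "0 < r" using l by simp
    have bound: "norm (int_iter m w) \<le> (C + D) * r powi m" for m
    proof (cases m rule: int_cases2)
      case (nonneg n)
      have "norm (int_iter m w) \<le> C * l1 ^ n" using C by (simp add: nonneg)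
      also have "\<dots> \<le> (C + D) * r ^ n" using CD l by (intro mult_mono power_mono) auto
      finally show ?thesis by (simp add: nonneg)
    next
      case (nonpos n)
      have "norm (int_iter m w) \<le> D * (1 / l2) ^ n" using D by (simp add: nonpos)
      also have "\<dots> \<le> (C + D) * (1 / r) ^ n"
        using CD l r by (intro mult_mono power_mono frac_le) auto
      finally show ?thesis by (simp add: nonpos power_int_minus power_one_over inverse_eq_divide)
    qed
    have "w \<bullet> w = 0"
    proof -
      \<comment> \<open>Testing against \<open>w\<close> itself turns the coordinate at time 0 into
        \<open>w \<bullet> w\<close>.\<close>
      have "orbit_coord w w = (\<lambda>m. 0)"
      proof (rule bounded_solution_eq_0[OF ann Z r])
        fix m
        have "cmod (orbit_coord w w m) \<le> norm w * norm (int_iter m w)"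
          by (simp add: orbit_coord_def Cauchy_Schwarz_ineq2)
        also have "\<dots> \<le> norm w * ((C + D) * r powi m)" by (intro mult_left_mono bound) simp
        finally show "cmod (orbit_coord w w m) \<le> norm w * (C + D) * r powi m"
          by (simp add: mult.assoc)
      qed simp_all
      from fun_cong[OF this, of 0] show ?thesis by (simp add: orbit_coord_def int_iter_def)
    qed
    then show "w = 0" by simp
  qed
  moreover have "0 \<in> decay_space M l1 \<inter> decay_space N (1 / l2)"
    using M N subspace_decay_space subspace_0 by blast
  ultimately show ?thesis by blast
qed

text \<open>In the Bezout identity \<open>a * roots_poly Z + b * roots_poly W = 1\<close> the second
  summand maps orbits to solutions of the recurrence of \<open>Z\<close>, which decay forwards, and
  the first to solutions of that of \<open>W\<close>, which decay backwards.\<close>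

lemma decay_spaces_sum:
  assumes ann: "\<And>u w. shift_poly (roots_poly (Z + W)) (orbit_coord u w) = (\<lambda>m. 0)"
    and Z: "\<And>z. z \<in># Z \<Longrightarrow> cmod z < l1" and W: "\<And>z. z \<in># W \<Longrightarrow> l2 < cmod z"
    and l: "0 < l1" "l1 < l2"
  shows "\<exists>a\<in>decay_space M l1. \<exists>b\<in>decay_space N (1 / l2). w = a + b"
proof -
  have "set_mset Z \<inter> set_mset W = {}" using Z W l(2) by fastforce
  then obtain a b where ab: "a * roots_poly Z + b * roots_poly W = 1"
    using comaximal_roots_poly by blast
  define s where "s = poly_map (b * roots_poly W) w"
  define t where "t = poly_map (a * roots_poly Z) w"
  have prod: "roots_poly (Z + W) = roots_poly Z * roots_poly W" by (simp add: roots_poly_def)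
  have zero: "shift_poly c (shift_poly (roots_poly (Z + W)) (orbit_coord u w)) = (\<lambda>m. 0)" for c u
    by (auto simp: ann)
  have "shift_poly (roots_poly Z) (shift_poly (b * roots_poly W) (orbit_coord u w)) = (\<lambda>m. 0)" for u
    using zero[of b u] by (simp only: prod flip: shift_poly_mult) (simp only: ac_simps)
  then have s: "s \<in> decay_space M l1"
    unfolding s_def using Z by (intro in_decay_spaceI funpow_poly_map_decay)
  have "shift_poly (roots_poly W) (shift_poly (a * roots_poly Z) (orbit_coord u w)) = (\<lambda>m. 0)" for u
    using zero[of a u] by (simp only: prod flip: shift_poly_mult) (simp only: ac_simps)
  then have t: "t \<in> decay_space N (1 / l2)"
    unfolding t_def using W l by (intro in_decay_spaceI funpow_inverse_poly_map_decay) auto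
  have "u \<bullet> w = u \<bullet> (s + t)" for u
  proof -
    have "u \<bullet> (s + t) = Re (shift_poly (a * roots_poly Z + b * roots_poly W) (orbit_coord u w) 0)"
      using inner_int_iter_poly_map[of u 0 "b * roots_poly W" w]
        inner_int_iter_poly_map[of u 0 "a * roots_poly Z" w]
      by (simp add: s_def t_def shift_poly_add inner_add_right int_iter_def)
    also have "\<dots> = u \<bullet> w"
      unfolding ab by (simp add: orbit_coord_def one_pCons shift_poly_pCons int_iter_def)
    finally show ?thesis by simp
  qed
  then have "w = s + t" by (metis vector_eq_rdot inner_commute)
  then show ?thesis using s t by blast
qed

text \<open>There are finitely many roots and none on the circle of radius \<open>r\<close>, so a
  whole annulus around it is free of roots; \<open>l1\<close> and \<open>l2\<close> are chosen
  inside that annulus.\<close>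

lemma hyperbolic_splitting:
  assumes p: "p \<noteq> 0" and ann: "\<And>u w. shift_poly p (orbit_coord u w) = (\<lambda>m. 0)"
    and r: "0 < r" "\<And>z. poly p z = 0 \<Longrightarrow> cmod z \<noteq> r"
  obtains l1 l2 where "0 < l1" "l1 < r" "r < l2"
    "decay_space M l1 \<inter> decay_space N (1 / l2) = {0}"
    "{a + b | a b. a \<in> decay_space M l1 \<and> b \<in> decay_space N (1 / l2)} = UNIV"
proof -
  define R where "R = proots p"
  define Z where "Z = filter_mset (\<lambda>z. cmod z < r) R"
  define W where "W = filter_mset (\<lambda>z. \<not> cmod z < r) R"
  have R: "R = Z + W" by (simp add: Z_def W_def multiset_partition[symmetric])
  have Rr: "cmod z \<noteq> r" if "z \<in># R" for z using that p r(2) by (simp add: R_def)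
  have "shift_poly p x = shift_poly (smult (lead_coeff p) (roots_poly R)) x" for x
    using complex_poly_decompose_multiset[of p] by (simp add: R_def roots_poly_def)
  then have "lead_coeff p * shift_poly (roots_poly R) (orbit_coord u w) m = 0" for u w m
    using ann[of u w] by (metis shift_poly_smult)
  then have annR: "shift_poly (roots_poly R) (orbit_coord u w) = (\<lambda>m. 0)" for u w
    using p by auto
  have "\<exists>l<r. 0 < l \<and> (\<forall>z\<in>#Z. cmod z < l)"
  proof -
    \<comment> \<open>The inserted 0 keeps \<open>l\<close> positive and covers the case of no roots
      inside; \<open>r + 1\<close> plays the latter part for \<open>W\<close> below.\<close>
    have "Max (insert 0 (cmod ` set_mset Z)) < r" using r(1) by (auto simp: Z_def)
    then obtain l where "Max (insert 0 (cmod ` set_mset Z)) < l" "l < r" using dense by blast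
    then show ?thesis by auto
  qed
  then obtain l1 where l1: "l1 < r" "0 < l1" "\<And>z. z \<in># Z \<Longrightarrow> cmod z < l1" by blast
  have "\<exists>l>r. \<forall>z\<in>#W. l < cmod z"
  proof -
    have "r < cmod z" if "z \<in># W" for z using that Rr[of z] by (auto simp: W_def)
    then have "r < Min (insert (r + 1) (cmod ` set_mset W))" by auto
    then obtain l where "l < Min (insert (r + 1) (cmod ` set_mset W))" "r < l" using dense by blast
    then show ?thesis by auto
  qed
  then obtain l2 where l2: "r < l2" "\<And>z. z \<in># W \<Longrightarrow> l2 < cmod z" by blast
  show thesis
  proof (rule that[of l1 l2])
    show "decay_space M l1 \<inter> decay_space N (1 / l2) = {0}"
      using annR Rr l1 l2 by (intro decay_spaces_disjoint)
    show "{a + b | a b. a \<in> decay_space M l1 \<and> b \<in> decay_space N (1 / l2)} = UNIV"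
      using decay_spaces_sum[of Z W l1 l2] annR l1 l2 unfolding R by fastforce
  qed (use l1 l2 in auto)
qed

end

section \<open>A polynomial annihilating all orbits\<close>

lemma linearly_dependent_family:
  fixes f :: "nat \<Rightarrow> 'v::euclidean_space"
  obtains c where "\<exists>j\<le>DIM('v). c j \<noteq> 0" "(\<Sum>j\<le>DIM('v). c j *\<^sub>R f j) = 0"
proof (cases "inj_on f {..DIM('v)}")
  case True
  then have "dependent (f ` {..DIM('v)})"
    by (intro dependent_biggerset) (simp add: card_image)
  then obtain c where c: "\<exists>v\<in>f ` {..DIM('v)}. c v \<noteq> 0" "(\<Sum>v\<in>f ` {..DIM('v)}. c v *\<^sub>R v) = 0"
    by (auto simp: dependent_finite)
  show thesis
    by (rule that[of "\<lambda>j. c (f j)"]) (use c True in \<open>auto simp: sum.reindex\<close>)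
next
  case False
  \<comment> \<open>A repeated vector yields the relation \<open>f i - f j = 0\<close>; the set of
    values would not show it.\<close>
  then obtain i j where ij: "i \<le> DIM('v)" "j \<le> DIM('v)" "i \<noteq> j" "f i = f j"
    by (auto simp: inj_on_def)
  define c :: "nat \<Rightarrow> real" where "c = (\<lambda>k. of_bool (k = i) - of_bool (k = j))"
  have single: "(\<Sum>k\<le>DIM('v). of_bool (k = l) *\<^sub>R f k) = f l" if "l \<le> DIM('v)" for l
  proof -
    have "(\<Sum>k\<le>DIM('v). of_bool (k = l) *\<^sub>R f k) = (\<Sum>k\<le>DIM('v). if k = l then f k else 0)"
      by (intro sum.cong) auto
    then show ?thesis using that by simp
  qed
  have "(\<Sum>k\<le>DIM('v). c k *\<^sub>R f k) = 0"
    using ij by (simp add: c_def scaleR_left_diff_distrib sum_subtractf single)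
  moreover have "\<exists>k\<le>DIM('v). c k \<noteq> 0" using ij by (intro exI[of _ i]) (simp add: c_def)
  ultimately show thesis by (rule that[rotated])
qed

text \<open>The powers of \<open>A\<close> with exponents up to the dimension of the matrix space
  are linearly dependent. Applying the relation to each point of an orbit, at negative times too,
  gives the recurrence.\<close>

lemma annihilating_poly:
  fixes A B :: "real^'n^'n"
  assumes AB: "linear_iso ((*v) A) ((*v) B)"
  obtains p where "p \<noteq> 0"
    "\<And>u w. shift_poly p (linear_iso.orbit_coord ((*v) A) ((*v) B) u w) = (\<lambda>m. 0)"
proof -
  interpret linear_iso "(*v) A" "(*v) B" by (rule AB)
  let ?P = "\<lambda>j. ((**) A ^^ j) (mat 1)"
  let ?N = "DIM(real^'n^'n)"
  have P: "?P j *v w = (((*v) A) ^^ j) w" for j w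
    by (induction j) (simp_all add: matrix_vector_mul_assoc[symmetric])
  obtain c where c: "\<exists>j\<le>?N. c j \<noteq> 0" "(\<Sum>j\<le>?N. c j *\<^sub>R ?P j) = 0"
    by (rule linearly_dependent_family)
  have lin: "(\<Sum>j\<le>n. c j *\<^sub>R (Q j *v y)) = (\<Sum>j\<le>n. c j *\<^sub>R Q j) *v y"
    for n :: nat and Q :: "nat \<Rightarrow> real^'n^'n" and y
    by (induction n) (simp_all add: matrix_vector_mult_add_rdistrib scaleR_matrix_vector_assoc)
  define p where "p = (\<Sum>j\<le>?N. monom (complex_of_real (c j)) j)"
  have coeff: "coeff p j = (if j \<le> ?N then complex_of_real (c j) else 0)" for j
    by (simp add: p_def coeff_sum)
  have "p \<noteq> 0" using c(1) coeff by (metis coeff_0 of_real_eq_0_iff)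
  moreover have "shift_poly p (orbit_coord u w) m = 0" for u w m
  proof -
    have "degree p \<le> ?N" by (rule degree_le) (simp add: coeff)
    then have "shift_poly p (orbit_coord u w) m =
        complex_of_real (u \<bullet> (\<Sum>j\<le>?N. c j *\<^sub>R (((*v) A) ^^ j) (int_iter m w)))"
      by (subst shift_poly_eq_sum)
        (auto simp: coeff orbit_coord_def int_iter_plus_nat inner_sum_right)
    also have "(\<Sum>j\<le>?N. c j *\<^sub>R (((*v) A) ^^ j) (int_iter m w)) =
        (\<Sum>j\<le>?N. c j *\<^sub>R ?P j) *v int_iter m w"
      unfolding P[symmetric] by (rule lin)
    finally show ?thesis unfolding c(2) by simp
  qed
  ultimately show thesis by (intro that[of p]) auto
qed


subsection \<open>Hyperbolic affine maps\<close>

lemma continuous_subbundle_const: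
  assumes "subspace E"
  shows "continuous_subbundle (\<lambda>x::'a::euclidean_space. E)"
proof -
  obtain B where B: "B \<subseteq> E" "independent B" "E \<subseteq> span B" using basis_exists by metis
  have span: "span B = E" using B assms by (metis span_mono span_eq_iff subset_antisym)
  obtain h where "bij_betw h {0..<card B} B"
    using ex_bij_betw_nat_finite[OF independent_imp_finite[OF B(2)]] by blast
  then have h: "inj_on h {..<card B}" "h ` {..<card B} = B"
    by (auto simp: bij_betw_def atLeast0LessThan)
  show ?thesis
    unfolding continuous_subbundle_def
  proof
    fix x :: 'a
    show "\<exists>U (k::nat) X. open U \<and> x \<in> U \<and> (\<forall>i<k. continuous_on U (X i)) \<and>
        (\<forall>y\<in>U. inj_on (\<lambda>i. X i y) {..<k} \<and> independent ((\<lambda>i. X i y) ` {..<k}) \<and>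
               span ((\<lambda>i. X i y) ` {..<k}) = E)"
      by (rule exI[of _ UNIV], rule exI[of _ "card B"], rule exI[of _ "\<lambda>i y. h i"])
        (simp add: h B(2) span)
  qed
qed

lemma smooth_affine:
  fixes L :: "'a::euclidean_space \<Rightarrow> 'b::euclidean_space"
  shows "linear L \<Longrightarrow> smooth (\<lambda>x. L x + a)"
  by (intro smooth_add smooth_const smooth_bounded_linear) (simp add: linear_conv_bounded_linear)

lemma has_derivative_affine:
  fixes L :: "'a::euclidean_space \<Rightarrow> 'b::real_normed_vector"
  assumes "linear L"
  shows "((\<lambda>x. L x + a) has_derivative L) (at x)"
  using has_derivative_add_const[OF bounded_linear_imp_has_derivative] assms
  by (simp add: linear_conv_bounded_linear)

lemma frechet_derivative_affine_funpow:
  fixes L :: "'a::euclidean_space \<Rightarrow> 'a"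
  assumes "linear L"
  shows "frechet_derivative ((\<lambda>x. L x + a) ^^ m) (at x) = L ^^ m"
proof (rule frechet_derivative_eqI)
  show "((\<lambda>x. L x + a) ^^ m has_derivative L ^^ m) (at x)"
  proof (induction m)
    case 0
    then show ?case by (simp add: id_def)
  next
    case (Suc m)
    show ?case using diff_chain_at[OF Suc has_derivative_affine[OF assms]] by (simp add: comp_def)
  qed
qed

context linear_iso
begin

text \<open>Written with \<open>+ - N a\<close> so that the inverse is again a linear map plus a
  constant and the lemmas on affine maps apply to it.\<close>

lemma inv_affine: "inv (\<lambda>x. M x + a) = (\<lambda>y. N y + - N a)"
  by (rule inv_equality) (simp_all add: linear_add[OF N] linear_add[OF M] linear_diff[OF M] MN NM)

lemma smooth_diffeo_affine: "smooth_diffeo (\<lambda>x. M x + a)"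
proof -
  have "bij (\<lambda>x. M x + a)"
    by (rule o_bij[of "\<lambda>y. N y + - N a"])
      (auto simp: fun_eq_iff linear_add[OF N] linear_diff[OF M] MN NM)
  then show ?thesis
    unfolding smooth_diffeo_def inv_affine using smooth_affine M N by blast
qed

text \<open>The derivatives of the iterates do not depend on the base point, so a constant splitting
  and the Euclidean metric reduce the Anosov condition to estimates for \<open>M\<close> and
  \<open>N\<close>.\<close>

lemma anosov_wrt_affine:
  assumes sub: "subspace Es" "subspace Eu"
    and split: "Es \<inter> Eu = {0}" "{a + b | a b. a \<in> Es \<and> b \<in> Eu} = UNIV"
    and inv_sub: "M ` Es = Es" "M ` Eu = Eu"
    and C: "1 \<le> C" "0 < l" "l < 1"
    and s: "\<And>w m. w \<in> Es \<Longrightarrow> norm ((M ^^ m) w) \<le> C * l ^ m * norm w"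
    and u: "\<And>w m. w \<in> Eu \<Longrightarrow> norm ((N ^^ m) w) \<le> C * l ^ m * norm w"
  shows "(\<lambda>x. M x + a) \<in> anosov_diffs"
proof -
  have "invariant_splitting (\<lambda>x. M x + a) (\<lambda>x. Es) (\<lambda>x. Eu)"
    using sub split inv_sub frechet_derivative_eqI[OF has_derivative_affine[OF M]]
    by (simp add: invariant_splitting_def continuous_subbundle_const)
  then have "anosov_wrt (\<lambda>x. inner) (\<lambda>x. M x + a)"
    unfolding anosov_wrt_def inv_affine
    using C s u
    by (intro exI[of _ "\<lambda>x. Es"] exI[of _ "\<lambda>x. Eu"] exI[of _ C] exI[of _ l])
      (simp add: frechet_derivative_affine_funpow M N del: add_uminus_conv_diff)
  then show ?thesis
    unfolding anosov_diffs_def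
    using smooth_diffeo_imp_Diff1[OF smooth_diffeo_affine] riemannian_metric_inner complete_metric_inner
    by blast
qed

section \<open>Hyperbolicity of scaled maps\<close>

lemma linear_iso_scaleR:
  assumes "t \<noteq> 0"
  shows "linear_iso (\<lambda>x. t *\<^sub>R M x) (\<lambda>x. (1 / t) *\<^sub>R N x)"
  using assms by unfold_locales
    (simp_all add: linear_compose_scale_right M N linear_add[OF M] linear_add[OF N]
      scaleR_add_right linear_scale[OF M] linear_scale[OF N] MN NM)

lemma funpow_scaleR:
  fixes L :: "'a \<Rightarrow> 'a"
  assumes "linear L"
  shows "((\<lambda>x. t *\<^sub>R L x) ^^ m) w = t ^ m *\<^sub>R (L ^^ m) w"
  by (induction m) (simp_all add: linear_scale[OF assms])

text \<open>Scaling changes the rates and not the spaces: the splitting of \<open>M\<close> at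
  radius \<open>1 / t\<close> also serves \<open>t *\<^sub>R M x\<close>, because
  \<open>l1 < 1 / t < l2\<close> makes both \<open>t * l1\<close> and \<open>1 / (t * l2)\<close>
  less than 1.\<close>

lemma affine_scaled_anosov:
  assumes p: "p \<noteq> 0" and ann: "\<And>u w. shift_poly p (orbit_coord u w) = (\<lambda>m. 0)"
    and t: "0 < t" "\<And>z. poly p z = 0 \<Longrightarrow> cmod z \<noteq> 1 / t"
  shows "(\<lambda>x. t *\<^sub>R M x + a) \<in> anosov_diffs"
proof -
  interpret T: linear_iso "\<lambda>x. t *\<^sub>R M x" "\<lambda>x. (1 / t) *\<^sub>R N x"
    using t(1) by (intro linear_iso_scaleR) simp
  have r: "0 < 1 / t" using t(1) by simp
  obtain l1 l2 where l: "0 < l1" "l1 < 1 / t" "1 / t < l2"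
    and split: "decay_space M l1 \<inter> decay_space N (1 / l2) = {0}"
      "{a + b | a b. a \<in> decay_space M l1 \<and> b \<in> decay_space N (1 / l2)} = UNIV"
    by (rule hyperbolic_splitting[OF p ann r t(2)])
  have l2: "0 < l2" using l t by (meson less_trans zero_less_divide_1_iff)
  obtain C where C: "1 \<le> C" "\<And>w m. w \<in> decay_space M l1 \<Longrightarrow> norm ((M ^^ m) w) \<le> C * l1 ^ m * norm w"
    using decay_space_uniform[OF M l(1)] by blast
  obtain D where D: "1 \<le> D"
      "\<And>w m. w \<in> decay_space N (1 / l2) \<Longrightarrow> norm ((N ^^ m) w) \<le> D * (1 / l2) ^ m * norm w"
    using decay_space_uniform[OF N, of "1 / l2"] l2 by auto
  define l0 where "l0 = max (t * l1) (1 / (t * l2))"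
  have invE: "M ` decay_space M l1 = decay_space M l1"
    "M ` decay_space N (1 / l2) = decay_space N (1 / l2)"
  proof -
    show "M ` decay_space M l1 = decay_space M l1" by (rule image_decay_space[of M N, OF MN l(1)])
    have "N ` decay_space N (1 / l2) = decay_space N (1 / l2)"
      by (rule image_decay_space[of N M, OF NM]) (use l2 in simp)
    then have "M ` decay_space N (1 / l2) = M ` N ` decay_space N (1 / l2)" by simp
    then show "M ` decay_space N (1 / l2) = decay_space N (1 / l2)"
      by (simp add: image_image MN)
  qed
  have scaled: "(\<lambda>x. t *\<^sub>R M x) ` E = E" if "subspace E" "M ` E = E" for E
  proof -
    have "(*\<^sub>R) t ` E = E"
    proof
      show "E \<subseteq> (*\<^sub>R) t ` E"
      proof
        fix x assume "x \<in> E"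
        then have "(1 / t) *\<^sub>R x \<in> E" using that(1) by (simp add: subspace_scale)
        moreover have "x = t *\<^sub>R ((1 / t) *\<^sub>R x)" using t(1) by simp
        ultimately show "x \<in> (*\<^sub>R) t ` E" by blast
      qed
    qed (use that(1) in \<open>auto simp: subspace_scale\<close>)
    then show ?thesis using that(2) by (metis image_image)
  qed
  have sub: "subspace (decay_space M l1)" "subspace (decay_space N (1 / l2))"
    by (rule subspace_decay_space[OF M], rule subspace_decay_space[OF N])
  show ?thesis
  proof (rule T.anosov_wrt_affine[of "decay_space M l1" "decay_space N (1 / l2)" "max C D" l0])
    show l0: "0 < l0" and "l0 < 1"
      using l l2 t(1) by (auto simp: l0_def field_simps less_max_iff_disj)
    fix w m
    show "norm (((\<lambda>x. t *\<^sub>R M x) ^^ m) w) \<le> max C D * l0 ^ m * norm w"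
      if "w \<in> decay_space M l1"
    proof -
      have "norm (((\<lambda>x. t *\<^sub>R M x) ^^ m) w) \<le> t ^ m * (C * l1 ^ m * norm w)"
        using C(2)[OF that, of m] t(1) by (simp add: funpow_scaleR[OF M])
      also have "\<dots> = C * (t * l1) ^ m * norm w" by (simp add: power_mult_distrib)
      also have "\<dots> \<le> max C D * l0 ^ m * norm w"
        using C(1) l(1) t(1) l0 by (intro mult_mono power_mono) (auto simp: l0_def)
      finally show ?thesis .
    qed
    show "norm (((\<lambda>x. (1 / t) *\<^sub>R N x) ^^ m) w) \<le> max C D * l0 ^ m * norm w"
      if "w \<in> decay_space N (1 / l2)"
    proof -
      have "norm (((\<lambda>x. (1 / t) *\<^sub>R N x) ^^ m) w) = (1 / t) ^ m * norm ((N ^^ m) w)"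
        using t(1) by (simp add: funpow_scaleR[OF N])
      also have "\<dots> \<le> (1 / t) ^ m * (D * (1 / l2) ^ m * norm w)"
        using D(2)[OF that, of m] t(1) by (intro mult_left_mono) auto
      also have "\<dots> = D * (1 / (t * l2)) ^ m * norm w"
        by (simp add: power_mult_distrib power_divide)
      also have "\<dots> \<le> max C D * l0 ^ m * norm w"
        using D(1) l2 t(1) l0 by (intro mult_mono power_mono) (auto simp: l0_def)
      finally show ?thesis .
    qed
  qed (use split scaled[OF sub(1) invE(1)] scaled[OF sub(2) invE(2)] sub C(1) in simp_all)
qed

lemma eventually_affine_scaled_anosov:
  assumes p: "p \<noteq> 0" and ann: "\<And>u w. shift_poly p (orbit_coord u w) = (\<lambda>m. 0)"
  shows "\<forall>\<^sub>F e in at 0. (\<lambda>x. exp e *\<^sub>R M x + a) \<in> anosov_diffs"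
proof -
  \<comment> \<open>These are the \<open>e\<close> for which a root lies on the circle of radius
    \<open>1 / exp e\<close>. The value 0 may be among them, but \<open>at 0\<close> is a punctured
    filter.\<close>
  let ?S = "(\<lambda>z. ln (1 / cmod z)) ` {z. poly p z = 0}"
  have "finite ?S" using p by (simp add: poly_roots_finite)
  then have "open (- (?S - {0}))" by (intro open_Compl finite_imp_closed finite_Diff)
  then have "\<forall>\<^sub>F e in at 0. e \<in> - (?S - {0}) - {0}" by (rule eventually_at_in_open) simp
  then show ?thesis
  proof (rule eventually_mono)
    fix e assume e: "e \<in> - (?S - {0}) - {0}"
    have "cmod z \<noteq> 1 / exp e" if "poly p z = 0" for z
    proof
      assume "cmod z = 1 / exp e"
      then have "e = ln (1 / cmod z)" by simp
      then show False using e that by blast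
    qed
    then show "(\<lambda>x. exp e *\<^sub>R M x + a) \<in> anosov_diffs" by (intro affine_scaled_anosov[OF p ann]) auto
  qed
qed

lemma limitin_affine_scaled:
  "limitin Diff1_topology (\<lambda>e x. exp e *\<^sub>R M x + a) (\<lambda>x. M x + a) (at 0)"
proof -
  have iso: "linear_iso (\<lambda>x. exp e *\<^sub>R M x) (\<lambda>x. (1 / exp e) *\<^sub>R N x)" for e
    by (rule linear_iso_scaleR) simp
  have sm: "smooth M" "smooth N"
    using M N smooth_bounded_linear linear_conv_bounded_linear by blast+
  show ?thesis
  proof (rule Cinf_loc_tendsto_imp_limitin_Diff1)
    show "(\<lambda>x. exp e *\<^sub>R M x + a) \<in> Diff1" for e
      by (rule smooth_diffeo_imp_Diff1[OF linear_iso.smooth_diffeo_affine[OF iso]])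
    show "(\<lambda>x. M x + a) \<in> Diff1" by (rule smooth_diffeo_imp_Diff1[OF smooth_diffeo_affine])
    have "((\<lambda>e::real. exp e - 1) \<longlongrightarrow> 0) (at 0)" by (auto intro!: tendsto_eq_intros)
    \<comment> \<open>The term with coefficient 0 only pads the expression to the shape of
      \<open>Cinf_loc_tendsto_perturb\<close>.\<close>
    then have "Cinf_loc_tendsto (\<lambda>e x. (M x + a) + (exp e - 1) *\<^sub>R M x + 0 *\<^sub>R a)
        (\<lambda>x. M x + a) (at (0::real))"
      by (intro Cinf_loc_tendsto_perturb smooth_add smooth_const tendsto_const sm)
    then show "Cinf_loc_tendsto (\<lambda>e x. exp e *\<^sub>R M x + a) (\<lambda>x. M x + a) (at (0::real))"
      by (simp add: algebra_simps)
    have "((\<lambda>e::real. 1 / exp e - 1) \<longlongrightarrow> 0) (at 0)" by (auto intro!: tendsto_eq_intros)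
    then have "Cinf_loc_tendsto (\<lambda>e y. (N y + - N a) + (1 / exp e - 1) *\<^sub>R (N y + - N a) + 0 *\<^sub>R a)
        (\<lambda>y. N y + - N a) (at (0::real))"
      by (intro Cinf_loc_tendsto_perturb smooth_add smooth_const tendsto_const sm)
    moreover have "(N y + - N a) + (b - 1) *\<^sub>R (N y + - N a) + 0 *\<^sub>R a = b *\<^sub>R N y + - (b *\<^sub>R N a)" for b y
      by (simp add: algebra_simps)
    ultimately show "Cinf_loc_tendsto (\<lambda>e. inv (\<lambda>x. exp e *\<^sub>R M x + a)) (inv (\<lambda>x. M x + a)) (at (0::real))"
      unfolding linear_iso.inv_affine[OF iso] inv_affine by simp
  qed
qed

end


subsection \<open>The perturbation\<close>

text \<open>Here \<open>T\<close> stands for the linear part minus the identity. As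
  \<open>- v\<close> is not in its range, \<open>T\<close> has a kernel, and the work is to find a
  kernel vector off the line spanned by some \<open>T z + v\<close>. Only for \<open>T = 0\<close>
  does this use \<open>dim\<close> directly; otherwise \<open>z\<close> is adjusted.\<close>

lemma fixpoint_free_affine_witness:
  fixes T :: "'a::euclidean_space \<Rightarrow> 'a"
  assumes dim: "DIM('a) \<ge> 2" and T: "linear T" and ne: "\<And>x. T x + v \<noteq> 0"
  obtains c k z where "T k = 0" "c \<bullet> k = 1" "c \<bullet> (T z + v) = 0"
proof -
  have "- v \<notin> range T"
  proof
    assume "- v \<in> range T"
    then obtain x where "T x = - v" by (metis imageE)
    then show False using ne[of x] by simp
  qed
  then have "\<not> inj T" using linear_injective_imp_surjective[OF T] by blast
  then obtain k0 where k0: "k0 \<noteq> 0" "T k0 = 0" using linear_injective_0[OF T] by blast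
  have v: "v \<noteq> 0" using ne[of 0] linear_0[OF T] by auto
  have "\<exists>k z. T k = 0 \<and> k \<notin> span {T z + v}"
  proof (cases "\<forall>x. T x = 0")
    case True
    obtain k where k: "k \<noteq> 0" "orthogonal v k" using orthogonal_to_vector_exists[OF dim] by blast
    then have "k \<notin> span {v}" by (auto simp: span_singleton orthogonal_def)
    then show ?thesis using True by (intro exI[of _ k] exI[of _ 0]) simp
  next
    case False
    then obtain z where z: "T z \<noteq> 0" by blast
    show ?thesis
    proof (cases "k0 \<in> span {v}")
      case False
      then show ?thesis using k0 linear_0[OF T] by (intro exI[of _ k0] exI[of _ 0]) simp
    next
      case True
      then obtain a where a: "k0 = a *\<^sub>R v" by (auto simp: span_singleton)
      have "k0 \<notin> span {T z + v}"
      proof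
        assume "k0 \<in> span {T z + v}"
        then obtain b where "k0 = b *\<^sub>R (T z + v)" by (auto simp: span_singleton)
        \<comment> \<open>Comparing the two expressions for \<open>k0\<close>: equal coefficients
          force \<open>k0 = 0\<close>, unequal ones put \<open>v\<close> in the range of
          \<open>T\<close>.\<close>
        then have b: "b *\<^sub>R T z = (a - b) *\<^sub>R v" using a by (simp add: algebra_simps)
        show False
        proof (cases "a = b")
          case True
          then show False using b z a k0(1) by auto
        next
          case False
          then have "T ((- b / (a - b)) *\<^sub>R z) + v = (- 1 / (a - b)) *\<^sub>R (b *\<^sub>R T z) + v"
            by (simp add: linear_scale[OF T] linear_neg[OF T])
          also have "\<dots> = 0" using False by (simp add: b)
          finally show False using ne by blast
        qed
      qed
      then show ?thesis using k0(2) by blast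
    qed
  qed
  then obtain k z where k: "T k = 0" and kz: "k \<notin> span {T z + v}" by blast
  define w where "w = T z + v"
  have w: "w \<noteq> 0" using ne by (simp add: w_def)
  \<comment> \<open>The component of \<open>k\<close> orthogonal to \<open>w\<close>. It is nonzero
    because \<open>k\<close> is off the line of \<open>w\<close>, and
    \<open>c \<bullet> k = c \<bullet> c\<close> fixes the normalising factor.\<close>
  define c where "c = k - (k \<bullet> w / (w \<bullet> w)) *\<^sub>R w"
  have cw: "c \<bullet> w = 0" using w by (simp add: c_def inner_diff_left)
  have "c \<noteq> 0" using kz by (auto simp: c_def span_singleton w_def)
  moreover have "c \<bullet> k = c \<bullet> c" using cw by (simp add: c_def inner_diff_right)
  ultimately show thesis using k cw by (intro that[of k "(1 / (c \<bullet> c)) *\<^sub>R c" z]) (simp_all add: w_def)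
qed

lemma smooth_inner_affine:
  fixes L :: "'a::euclidean_space \<Rightarrow> 'a"
  assumes "linear L"
  shows "smooth (\<lambda>x. c \<bullet> (L x + a))"
proof -
  have "linear (\<lambda>x. c \<bullet> L x)"
    using linear_compose[OF assms bounded_linear.linear[OF bounded_linear_inner_right]]
    by (simp add: comp_def)
  from smooth_affine[OF this] show ?thesis by (simp add: inner_add_right)
qed

lemma fixpoint_free_affine_perturbation:
  fixes M :: "'a::euclidean_space \<Rightarrow> 'a"
  assumes dim: "DIM('a) \<ge> 2" and iso: "linear_iso M N" and ne: "\<And>x. M x + v \<noteq> x"
  obtains h :: "real \<Rightarrow> 'a \<Rightarrow> 'a" where "\<And>e. smooth_diffeo (h e)" "\<And>e. e \<noteq> 0 \<Longrightarrow> h e \<notin> anosov_diffs"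
    "Cinf_loc_tendsto h (\<lambda>x. M x + v) (at 0)"
    "Cinf_loc_tendsto (\<lambda>e. inv (h e)) (inv (\<lambda>x. M x + v)) (at 0)"
proof -
  interpret linear_iso M N by (rule iso)
  have "linear (\<lambda>x. M x - x)" using M by (intro linear_compose_sub linear_ident)
  moreover have "(M x - x) + v \<noteq> 0" for x using ne[of x] by (simp add: algebra_simps)
  ultimately obtain c k z where k: "M k - k = 0" and ck: "c \<bullet> k = 1" and cw: "c \<bullet> (M z - z + v) = 0"
    by (rule fixpoint_free_affine_witness[OF dim])
  define w where "w = M z - z + v"
  have cw: "c \<bullet> w = 0" using cw by (simp add: w_def)
  define f where "f = (\<lambda>x. M x + v)"
  define g where "g = (\<lambda>y. N y + - N v)"
  have fg: "f (g y) = y" and gf: "g (f x) = x" for x y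
    by (simp_all add: f_def g_def linear_add[OF N] linear_diff[OF M] MN NM)
  have f_add: "f (x + y) = f x + M y" and g_add: "g (x + y) = g x + N y" for x y
    by (simp_all add: f_def g_def linear_add[OF M] linear_add[OF N])
  have inv_f: "inv f = g" unfolding f_def g_def by (rule inv_affine)
  define s where "s = (\<lambda>x. c \<bullet> f x)"
  define t where "t = (\<lambda>y. c \<bullet> y)"
  have sm: "smooth f" "smooth g" "smooth s" "smooth t"
    unfolding f_def g_def s_def t_def
    by (rule smooth_affine[OF M] smooth_affine[OF N] smooth_inner_affine[OF M]
        smooth_bounded_linear[OF bounded_linear_inner_right])+
  \<comment> \<open>The shear after \<open>f\<close>, with \<open>(1 - e * s x)\<^sup>2 - 1\<close>
    expanded in powers of \<open>e\<close> to fit \<open>Cinf_loc_tendsto_perturb\<close>. Since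
    \<open>c\<close> is orthogonal to \<open>w\<close>, the shear preserves \<open>t\<close>; hence
    \<open>h'\<close> can subtract the same multiple of \<open>w\<close> before applying
    \<open>g\<close>, which turns \<open>w\<close> into \<open>N w\<close>.\<close>
  define h where "h = (\<lambda>e x. f x + e *\<^sub>R (s x *\<^sub>R (- 2 *\<^sub>R w)) + e\<^sup>2 *\<^sub>R (s x *\<^sub>R (s x *\<^sub>R w)))"
  define h' where "h' = (\<lambda>e y. g y + e *\<^sub>R (t y *\<^sub>R (2 *\<^sub>R N w)) + e\<^sup>2 *\<^sub>R (t y *\<^sub>R (t y *\<^sub>R (- N w))))"
  have h_eq: "h e x = f x + ((e * s x)\<^sup>2 - 2 * (e * s x)) *\<^sub>R w" for e x
    by (simp add: h_def power2_eq_square algebra_simps)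
  have h'_eq: "h' e y = g y + (2 * (e * t y) - (e * t y)\<^sup>2) *\<^sub>R N w" for e y
    by (simp add: h'_def power2_eq_square algebra_simps)
  have hh': "h e (h' e y) = y" for e y
  proof -
    have f1: "f (h' e y) = y + (2 * (e * t y) - (e * t y)\<^sup>2) *\<^sub>R w"
      by (simp add: h'_eq f_add fg linear_scale[OF M] MN)
    then have "s (h' e y) = t y" by (simp add: s_def t_def inner_add_right cw)
    then show ?thesis by (simp add: h_eq f1 algebra_simps)
  qed
  have h'h: "h' e (h e x) = x" for e x
  proof -
    have "t (h e x) = s x" by (simp add: h_eq t_def s_def inner_add_right cw)
    moreover have "g (h e x) = x + ((e * s x)\<^sup>2 - 2 * (e * s x)) *\<^sub>R N w"
      by (simp only: h_eq g_add gf linear_scale[OF N])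
    ultimately show ?thesis by (simp add: h'_eq algebra_simps)
  qed
  have inv_h: "inv (h e) = h' e" for e by (rule inv_equality) (simp_all add: hh' h'h)
  have bij_h: "bij (h e)" for e
    by (rule o_bij[of "h' e"]) (auto simp: fun_eq_iff hh' h'h)
  have sm_h: "smooth (h e)" "smooth (h' e)" for e
    unfolding h_def h'_def by (intro smooth_add smooth_scaleR smooth_const sm)+
  have diffeo: "smooth_diffeo (h e)" for e
    by (simp add: smooth_diffeo_def inv_h bij_h sm_h)
  have lim: "((\<lambda>e. e) \<longlongrightarrow> 0) (at (0::real))" "((\<lambda>e. e\<^sup>2) \<longlongrightarrow> 0) (at (0::real))"
    by (auto intro!: tendsto_eq_intros)
  have lim_h: "Cinf_loc_tendsto h f (at 0)"
    unfolding h_def by (intro Cinf_loc_tendsto_perturb smooth_scaleR smooth_const sm lim)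
  have lim_h': "Cinf_loc_tendsto h' g (at 0)"
    unfolding h'_def by (intro Cinf_loc_tendsto_perturb smooth_scaleR smooth_const sm lim)
  have "h e \<notin> anosov_diffs" if e: "e \<noteq> 0" for e
  proof
    assume anosov: "h e \<in> anosov_diffs"
    \<comment> \<open>The point of the line \<open>z + \<real> k\<close> where
      \<open>c \<bullet> x = 1 / e\<close>. On this line \<open>f\<close> is translation by
      \<open>w\<close>, so \<open>e * s x = 1\<close> and the shear adds \<open>- w\<close>.\<close>
    define x where "x = z + (1 / e - c \<bullet> z) *\<^sub>R k"
    have Mk: "M k = k" using k by simp
    have fx: "f x = x + w"
      by (simp add: x_def f_def w_def linear_add[OF M] linear_scale[OF M] Mk)
    have sx: "s x = 1 / e"
      by (simp add: s_def fx inner_add_right cw) (simp add: x_def inner_add_right ck)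
    have hx: "h e x = x" using e by (simp add: h_eq fx sx)
    \<comment> \<open>The coefficient of \<open>w\<close> comes from differentiating
      \<open>\<tau>\<^sup>2 - 2 * \<tau>\<close> at \<open>\<tau> = e * s x = 1\<close>, where it is
      stationary.\<close>
    define D where "D = (\<lambda>d. M d + (2 * (e * (c \<bullet> M d)) * (e * s x) - 2 * (e * (c \<bullet> M d))) *\<^sub>R w)"
    have Df: "(f has_derivative M) (at x)" unfolding f_def by (rule has_derivative_affine[OF M])
    have "(h e has_derivative D) (at x)"
      unfolding h_eq[abs_def] s_def D_def
      by (rule derivative_eq_intros Df refl | simp)+
    moreover have "D k = k" using e by (simp add: D_def sx Mk)
    ultimately have "k = 0" using anosov_diffs_fixpoint_no_invariant_vector[OF anosov hx] by blast
    then show False using ck by simp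
  qed
  then show thesis
    using diffeo lim_h lim_h' unfolding inv_f[symmetric] inv_h[symmetric, abs_def] f_def
    by (intro that[of h])
qed

theorem theorem1p3:
  fixes A :: "real^'n^'n" and v :: "real^'n"
  assumes "CARD('n) \<ge> 2"
    and "invertible A"
    and "\<forall>x. A *v x + v \<noteq> x"
  shows "(\<lambda>x. A *v x + v) \<in> Diff1_topology frontier_of anosov_diffs \<and>
    (\<exists>h :: real \<Rightarrow> real^'n \<Rightarrow> real^'n.
       (\<exists>\<delta>>0. \<forall>\<epsilon>. \<epsilon> \<noteq> 0 \<and> \<bar>\<epsilon>\<bar> < \<delta> \<longrightarrow> smooth_diffeo (h \<epsilon>) \<and> h \<epsilon> \<notin> anosov_diffs) \<and>
       Cinf_loc_tendsto h (\<lambda>x. A *v x + v) (at 0) \<and>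
       Cinf_loc_tendsto (\<lambda>\<epsilon>. inv (h \<epsilon>)) (inv (\<lambda>x. A *v x + v)) (at 0))"
proof -
  obtain B where B: "A ** B = mat 1" "B ** A = mat 1"
    using assms(2) by (auto simp: invertible_def)
  have iso: "linear_iso ((*v) A) ((*v) B)"
    by unfold_locales (simp_all add: matrix_vector_mul_assoc B matrix_vector_right_distrib
        matrix_vector_mult_scaleR scaleR_matrix_vector_assoc)
  interpret linear_iso "(*v) A" "(*v) B" by (rule iso)
  let ?f = "\<lambda>x. A *v x + v"
  obtain h :: "real \<Rightarrow> real^'n \<Rightarrow> real^'n" where h: "\<And>e. smooth_diffeo (h e)"
      "\<And>e. e \<noteq> 0 \<Longrightarrow> h e \<notin> anosov_diffs"
      "Cinf_loc_tendsto h ?f (at 0)" "Cinf_loc_tendsto (\<lambda>e. inv (h e)) (inv ?f) (at 0)"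
    by (rule fixpoint_free_affine_perturbation[of "(*v) A" "(*v) B" v]) (use assms iso in auto)
  have lim_h: "limitin Diff1_topology h ?f (at 0)"
    by (intro Cinf_loc_tendsto_imp_limitin_Diff1 smooth_diffeo_imp_Diff1 smooth_diffeo_affine h)
  have ev_h: "\<forall>\<^sub>F e in at 0. h e \<notin> anosov_diffs"
    using h(2) by (simp add: eventually_at_filter)
  obtain p where p: "p \<noteq> 0" "\<And>u w. shift_poly p (orbit_coord u w) = (\<lambda>m. 0)"
    using annihilating_poly[OF iso] by blast
  have "?f \<in> Diff1_topology frontier_of anosov_diffs"
    by (rule limitin_imp_frontier_of[OF limitin_affine_scaled _ eventually_affine_scaled_anosov[OF p]
          lim_h _ ev_h]) simp_all
  moreover have "\<exists>\<delta>>0. \<forall>\<epsilon>. \<epsilon> \<noteq> 0 \<and> \<bar>\<epsilon>\<bar> < \<delta> \<longrightarrow> smooth_diffeo (h \<epsilon>) \<and> h \<epsilon> \<notin> anosov_diffs"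
    using h(1,2) by (intro exI[of _ 1]) simp
  ultimately show ?thesis using h(3,4) by blast
qed

end
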